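(* There exists $\delta>0$ such that the following holds for every $F\in C^2(\mathbb{R},\mathbb{R})$ with $\|F\|_\infty<\delta$. Let $V(u)=\frac{u^2}{2}+F(u)$ and, for every integer $n\ge1$ and $M\in\mathbb{R}$, let $\sigma_M$ be the probability measure on $\mathbb{R}^n$ $$\sigma_M(dx_1,\ldots,dx_n)=\frac{1}{Z_{\sigma_M}}\exp\Bigl(-\sum_{i=1}^n V(x_i)-V\bigl(M-\sum_{i=1}^n x_i\bigr)\Bigr)\,dx_1\cdots dx_n,$$ where $Z_{\sigma_M}$ is the normalizing constant. Then there exists a positive constant $\mathcal{P}$ depending only on $\|F\|_\infty$ such that for every $n\ge1$, every $M\in\mathbb{R}$ and every smooth $f:\mathbb{R}^n\to\mathbb{R}$, $$\mathbf{Var}_{\sigma_M}(f)\le\mathcal{P}\,\mathbf{E}_{\sigma_M}\bigl(|\nabla f|^2\bigr).$$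
   Context: For a probability measure $Q$: $\mathbf{E}_Q(f)=\int f\,dQ$ and $\mathbf{Var}_Q(f)=\mathbf{E}_Q(f^2)-\mathbf{E}_Q(f)^2$. For smooth $f:\mathbb{R}^n\to\mathbb{R}$, $|\nabla f|^2=\sum_{i=1}^n|\partial_i f|^2$. Nothing is asserted when the right-hand side of the inequality is infinite. $\|\cdot\|_\infty$ is the sup norm on $\mathbb{R}$. "Depending only on $\|F\|_\infty$" means the same constant works for all $n$, all $M$, and all admissible $F$ with the same value of $\|F\|_\infty$. *)

theory Defs
  imports "HOL-Probability.Probability"
begin

(* The constant in the theorem is uniform in n, so n cannot be a type.  A point of R^n is a
   function in the extensional product over {1..n}; this set carries the Lebesgue measure
   Pi_M {1..n} (%_. lborel), and, as a subspace of the product topology on nat => real,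
   the Euclidean topology.  A function R^n -> R is a function on nat => real of which only the
   values on this set matter. *)
abbreviation Rn :: "nat \<Rightarrow> (nat \<Rightarrow> real) set" where
  "Rn n \<equiv> PiE {1..n} (\<lambda>_. UNIV)"

definition partial :: "nat \<Rightarrow> ((nat \<Rightarrow> real) \<Rightarrow> real) \<Rightarrow> (nat \<Rightarrow> real) \<Rightarrow> real" where
  "partial i f x = deriv (\<lambda>t. f (x(i := t))) (x i)"

(* C^infinity: the iterated partial derivatives of every order (the list gives the indices) exist
   and are continuous. *)
definition smooth_Rn :: "nat \<Rightarrow> ((nat \<Rightarrow> real) \<Rightarrow> real) \<Rightarrow> bool" where
  "smooth_Rn n f \<longleftrightarrow>
    (\<forall>js. set js \<subseteq> {1..n} \<longrightarrow>
      continuous_on (Rn n) (foldr partial js f) \<and>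
      (\<forall>i\<in>{1..n}. \<forall>x\<in>Rn n.
        (\<lambda>t. foldr partial js f (x(i := t))) differentiable (at (x i))))"

definition grad_sq :: "nat \<Rightarrow> ((nat \<Rightarrow> real) \<Rightarrow> real) \<Rightarrow> (nat \<Rightarrow> real) \<Rightarrow> real" where
  "grad_sq n f x = (\<Sum>i=1..n. \<bar>partial i f x\<bar>\<^sup>2)"

definition C2 :: "(real \<Rightarrow> real) \<Rightarrow> bool" where
  "C2 F \<longleftrightarrow> (\<exists>F' F''. (\<forall>u. (F has_real_derivative F' u) (at u)) \<and>
                     (\<forall>u. (F' has_real_derivative F'' u) (at u)) \<and>
                     continuous_on UNIV F'')"

(* Meaningful only for bounded F; boundedness is always required alongside it. *)
definition sup_norm :: "(real \<Rightarrow> real) \<Rightarrow> real" where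
  "sup_norm F = (SUP u. \<bar>F u\<bar>)"

definition V :: "(real \<Rightarrow> real) \<Rightarrow> real \<Rightarrow> real" where
  "V F u = u\<^sup>2 / 2 + F u"

definition weight :: "(real \<Rightarrow> real) \<Rightarrow> nat \<Rightarrow> real \<Rightarrow> (nat \<Rightarrow> real) \<Rightarrow> real" where
  "weight F n M x = exp (- (\<Sum>i=1..n. V F (x i)) - V F (M - (\<Sum>i=1..n. x i)))"

definition Z_sigma :: "(real \<Rightarrow> real) \<Rightarrow> nat \<Rightarrow> real \<Rightarrow> real" where
  "Z_sigma F n M = (\<integral>x. weight F n M x \<partial>Pi\<^sub>M {1..n} (\<lambda>_. lborel))"

definition sigma_meas :: "(real \<Rightarrow> real) \<Rightarrow> nat \<Rightarrow> real \<Rightarrow> (nat \<Rightarrow> real) measure" where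
  "sigma_meas F n M =
    density (Pi\<^sub>M {1..n} (\<lambda>_. lborel)) (\<lambda>x. ennreal (weight F n M x / Z_sigma F n M))"

definition Expect :: "'a measure \<Rightarrow> ('a \<Rightarrow> real) \<Rightarrow> real" where
  "Expect Q f = (\<integral>x. f x \<partial>Q)"

(* The real-valued integral of a non-integrable function is 0, so an upper bound on Var Q f has its
   intended meaning only together with the integrability of f^2. *)
definition Var :: "'a measure \<Rightarrow> ('a \<Rightarrow> real) \<Rightarrow> real" where
  "Var Q f = Expect Q (\<lambda>x. (f x)\<^sup>2) - (Expect Q f)\<^sup>2"

(* The Bochner integral defining the normalizing constant is never the junk value 0. *)
lemma prob_space_sigma_meas:
  assumes cont: "continuous_on UNIV F" and bdd: "bounded (range F)"
  shows "prob_space (sigma_meas F n M)"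
proof -
  let ?L = "Pi\<^sub>M {1..n} (\<lambda>_::nat. lborel :: real measure)"
  interpret product_sigma_finite "\<lambda>_::nat. lborel :: real measure"
    by (simp add: product_sigma_finite_def lborel.sigma_finite_measure_axioms)
  have F_meas [measurable]: "F \<in> borel_measurable borel"
    using cont by (rule borel_measurable_continuous_onI)
  have w_meas [measurable]: "weight F n M \<in> borel_measurable ?L"
    unfolding weight_def V_def by measurable
  have w_pos: "weight F n M x > 0" for x
    by (simp add: weight_def)
  obtain B where B: "\<And>u. \<bar>F u\<bar> \<le> B"
    using bdd by (auto simp: bounded_iff)
  have gauss: "integrable lborel (\<lambda>u::real. exp (B - u\<^sup>2 / 2))"
  proof -
    have "integrable lborel (\<lambda>u::real. exp B * sqrt (2 * pi) * normal_density 0 1 u)"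
      by (rule integrable_mult_right) simp
    moreover have "exp B * sqrt (2 * pi) * normal_density 0 1 u = exp (B - u\<^sup>2 / 2)" for u
      by (simp add: std_normal_density_def mult_exp_exp)
    ultimately show ?thesis
      by (simp only:)
  qed
  have "integrable ?L (\<lambda>x. exp B * (\<Prod>i=1..n. exp (B - (x i)\<^sup>2 / 2)))"
    by (intro integrable_mult_right product_integrable_prod) (auto intro: gauss)
  then have w_int: "integrable ?L (weight F n M)"
  proof (rule Bochner_Integration.integrable_bound[OF _ w_meas], intro AE_I2)
    fix x :: "nat \<Rightarrow> real"
    have 1: "- V F u \<le> B - u\<^sup>2 / 2" for u
      using B[of u] by (simp add: V_def)
    have 2: "- V F u \<le> B" for u
      using 1[of u] zero_le_power2[of u] by linarith
    have "(\<Sum>i=1..n. - V F (x i)) \<le> (\<Sum>i=1..n. B - (x i)\<^sup>2 / 2)"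
      by (intro sum_mono 1)
    then have "weight F n M x \<le> exp ((\<Sum>i=1..n. B - (x i)\<^sup>2 / 2) + B)"
      unfolding weight_def exp_le_cancel_iff using 2[of "M - (\<Sum>i=1..n. x i)"]
      by (simp only: sum_negf)
    also have "\<dots> = exp B * (\<Prod>i=1..n. exp (B - (x i)\<^sup>2 / 2))"
      by (simp add: exp_add exp_sum)
    finally show "norm (weight F n M x) \<le> norm (exp B * (\<Prod>i=1..n. exp (B - (x i)\<^sup>2 / 2)))"
      by (simp add: weight_def prod_nonneg)
  qed
  have nn: "(\<integral>\<^sup>+x. ennreal (weight F n M x) \<partial>?L) = ennreal (Z_sigma F n M)"
    unfolding Z_sigma_def using w_int by (intro nn_integral_eq_integral) (auto intro: less_imp_le w_pos)
  have "Z_sigma F n M \<noteq> 0"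
  proof
    assume "Z_sigma F n M = 0"
    then have "AE x in ?L. weight F n M x = 0"
      using integral_nonneg_eq_0_iff_AE[OF w_int] by (simp add: Z_sigma_def less_imp_le w_pos)
    then have "emeasure ?L (space ?L) = 0"
      using AE_iff_measurable[of "space ?L" ?L "\<lambda>x. weight F n M x = 0"] w_pos
      by (simp add: less_imp_neq[THEN not_sym])
    moreover have "emeasure ?L (space ?L) = (\<Prod>i\<in>{1..n}. emeasure lborel (UNIV :: real set))"
      unfolding space_PiM by (subst emeasure_PiM) auto
    ultimately show False
      by simp
  qed
  moreover have "Z_sigma F n M \<ge> 0"
    unfolding Z_sigma_def by (intro Bochner_Integration.integral_nonneg) (simp add: less_imp_le w_pos)
  ultimately have Z: "Z_sigma F n M > 0"
    by simp
  show ?thesis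
  proof
    have "emeasure (sigma_meas F n M) (space (sigma_meas F n M)) =
        (\<integral>\<^sup>+x. ennreal (weight F n M x / Z_sigma F n M) * indicator (space ?L) x \<partial>?L)"
      unfolding sigma_meas_def space_density by (rule emeasure_density) measurable
    also have "\<dots> = (\<integral>\<^sup>+x. ennreal (weight F n M x) / ennreal (Z_sigma F n M) \<partial>?L)"
      using Z by (intro nn_integral_cong) (simp add: divide_ennreal less_imp_le w_pos)
    also have "\<dots> = (\<integral>\<^sup>+x. ennreal (weight F n M x) \<partial>?L) / ennreal (Z_sigma F n M)"
      by (rule nn_integral_divide) measurable
    also have "\<dots> = 1"
      unfolding nn using Z by (simp add: divide_ennreal)
    finally show "emeasure (sigma_meas F n M) (space (sigma_meas F n M)) = 1" .
  qed
qed

end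

theory Submission
  imports Defs
begin

text \<open>Multiplying a density by a factor in \<open>[exp (-\<epsilon>), exp \<epsilon>]\<close> costs at most \<open>exp (2 \<epsilon>)\<close> in the Poincare
  constant, so the term \<open>F (M - \<Sum>x)\<close> may be dropped from the Hamiltonian. What remains is
  \<open>\<Sum>V(x\<^sub>i) + (M - S)\<^sup>2/2\<close> with \<open>S = \<Sum>x\<^sub>i\<close>. For it one shows by induction on the number of
  coordinates the inequality \<open>Var f \<le> E \<langle>\<nabla>f, B \<nabla>f\<rangle>\<close>, where \<open>B\<close> is the inverse of the matrix with
  diagonal \<open>\<lambda> = 2 exp (-2 \<epsilon>)\<close> and off-diagonal entries \<open>1\<close>; as \<open>\<lambda> > 1\<close>, this gives a constant
  \<open>1 / (\<lambda> - 1)\<close> independent of the dimension.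

  In the induction step one conditions on one coordinate \<open>x\<^sub>i = t\<close>. Its marginal density is
  \<open>exp (-F - U)\<close> with \<open>U'' = 2 - Var (S | t)\<close>, and the derivative of \<open>g t = E (f | t)\<close> is
  \<open>E (\<partial>\<^sub>i f | t) - Cov (f, S | t)\<close>. The one-dimensional Brascamp-Lieb inequality for \<open>U\<close> with the
  bounded perturbation \<open>F\<close> bounds the variance of \<open>g\<close> by the mean of \<open>g'\<^sup>2 / (\<lambda> - Var (S | t))\<close>.
  Adding the conditional variance, the sum is \<open>Var (f - s S | t)\<close> plus explicit terms for a
  suitable real \<open>s\<close>, and the induction hypothesis for \<open>f - s S\<close> and a Schur complement conclude.

  All of this is done on the box \<open>[-r, r]\<^sup>n\<close>, where every integrand is bounded; then \<open>r\<close> tends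
  to infinity.\<close>

section \<open>The Brascamp-Lieb inequality on an interval\<close>

text \<open>With \<open>G y = \<integral>\<^sub>a\<^sup>y h\<^sup>2 / k\<close>, Cauchy-Schwarz gives \<open>(g y - g a)\<^sup>2 \<le> G y * A y\<close>, and
  \<open>A * p = - p'\<close> is then removed by an integration by parts.\<close>
lemma integral_square_diff_le:
  fixes A g p h k :: "real \<Rightarrow> real"
  assumes "a \<le> b" and Aa: "A a \<ge> 0"
    and A: "\<And>x. (A has_real_derivative k x) (at x)"
    and g: "\<And>x. (g has_real_derivative h x) (at x)"
    and p: "\<And>x. (p has_real_derivative - (A x * p x)) (at x)"
    and k: "\<And>x. k x > 0" and p0: "\<And>x. p x > 0"
    and ch: "continuous_on UNIV h" and ck: "continuous_on UNIV k"
  shows "integral {a..b} (\<lambda>x. (g x - g a)\<^sup>2 * p x) \<le> integral {a..b} (\<lambda>x. (h x)\<^sup>2 / k x * p x)"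
proof -
  define G where "G = (\<lambda>y. integral {a..y} (\<lambda>x. (h x)\<^sup>2 / k x))"
  have cA: "continuous_on S A" and cg: "continuous_on S g" and cp: "continuous_on S p" for S
    using A g p by (meson DERIV_isCont continuous_at_imp_continuous_on)+
  have ch': "continuous_on S h" and ck': "continuous_on S k" for S
    using ch ck continuous_on_subset by blast+
  have k0: "k x \<noteq> 0" for x
    using k[of x] by simp
  have cH: "continuous_on S (\<lambda>x. (h x)\<^sup>2 / k x)" for S
    by (intro continuous_intros ch' ck') (simp add: k0)
  have dG: "(G has_real_derivative (h y)\<^sup>2 / k y) (at y within {a..b})" if "y \<in> {a..b}" for y
    unfolding G_def using that by (intro integral_has_real_derivative cH)
  have cs: "(g y - g a)\<^sup>2 \<le> G y * (A y - A a)" if "a \<le> y" for y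
  proof (cases "y = a")
    case False
    then have "a < y" using that by simp
    then have AA: "A y - A a > 0"
      using DERIV_pos_imp_increasing[of a y A] A k by force
    \<comment> \<open>The minimizer over all \<open>s\<close> of the integral of
      \<open>(h x - s * k x)\<^sup>2 / k x\<close> over \<open>{a..y}\<close>; nonnegativity at the
      minimum is Cauchy-Schwarz.\<close>
    define s where "s = (g y - g a) / (A y - A a)"
    have "((\<lambda>x. 2 * s * h x - s\<^sup>2 * k x) has_integral
           (2 * s * g y - s\<^sup>2 * A y) - (2 * s * g a - s\<^sup>2 * A a)) {a..y}"
      using that
      by (intro fundamental_theorem_of_calculus)
        (auto intro!: derivative_eq_intros DERIV_subset[OF A] DERIV_subset[OF g]
              simp: has_real_derivative_iff_has_vector_derivative[symmetric])
    moreover have "((\<lambda>x. (h x)\<^sup>2 / k x) has_integral G y) {a..y}"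
      unfolding G_def by (intro integrable_integral integrable_continuous_real cH)
    ultimately have "(2 * s * g y - s\<^sup>2 * A y) - (2 * s * g a - s\<^sup>2 * A a) \<le> G y"
    proof (rule has_integral_le)
      fix x
      have "0 \<le> (h x - s * k x)\<^sup>2 / k x"
        using k[of x] by simp
      also have "\<dots> = (h x)\<^sup>2 / k x - (2 * s * h x - s\<^sup>2 * k x)"
        using k0[of x] by (simp add: field_simps power2_eq_square)
      finally show "2 * s * h x - s\<^sup>2 * k x \<le> (h x)\<^sup>2 / k x"
        by simp
    qed
    also have "(2 * s * g y - s\<^sup>2 * A y) - (2 * s * g a - s\<^sup>2 * A a) = (g y - g a)\<^sup>2 / (A y - A a)"
      using AA unfolding s_def by (simp add: divide_simps) (simp add: power2_eq_square algebra_simps)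
    finally show ?thesis
      using AA by (simp add: divide_simps mult.commute)
  qed simp
  have G0: "G y \<ge> 0" for y
    unfolding G_def by (intro integral_nonneg integrable_continuous_real cH) (simp add: k less_imp_le)
  have cG: "continuous_on {a..b} G"
    using dG by (meson DERIV_continuous continuous_on_eq_continuous_within)
  \<comment> \<open>By parts for \<open>G * p\<close>: the boundary term at \<open>a\<close>
    vanishes because \<open>G a = 0\<close>, the one at \<open>b\<close> is nonnegative and is
    dropped.\<close>
  have "((\<lambda>y. G y * p y) has_real_derivative (h y)\<^sup>2 / k y * p y + - (A y * p y) * G y) (at y within {a..b})"
    if "y \<in> {a..b}" for y
    by (rule DERIV_mult[OF dG[OF that] DERIV_subset[OF p]]) simp
  then have "((\<lambda>y. (h y)\<^sup>2 / k y * p y + - (A y * p y) * G y) has_integral G b * p b - G a * p a) {a..b}"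
    using \<open>a \<le> b\<close>
    by (intro fundamental_theorem_of_calculus)
      (simp_all only: has_real_derivative_iff_has_vector_derivative)
  then have "integral {a..b} (\<lambda>y. (h y)\<^sup>2 / k y * p y + - (A y * p y) * G y) = G b * p b"
    by (simp add: G_def integral_unique)
  moreover have "integral {a..b} (\<lambda>y. (h y)\<^sup>2 / k y * p y + - (A y * p y) * G y) =
      integral {a..b} (\<lambda>y. (h y)\<^sup>2 / k y * p y) - integral {a..b} (\<lambda>y. A y * p y * G y)"
    by (subst integral_diff[symmetric])
      (auto intro!: integrable_continuous_real continuous_intros cH cp cA cG simp: k0 ch' ck')
  moreover have "0 \<le> G b * p b"
    using G0 p0[of b] by simp
  ultimately have 1: "integral {a..b} (\<lambda>y. A y * p y * G y) \<le> integral {a..b} (\<lambda>y. (h y)\<^sup>2 / k y * p y)"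
    by simp
  have "integral {a..b} (\<lambda>y. (g y - g a)\<^sup>2 * p y) \<le> integral {a..b} (\<lambda>y. A y * p y * G y)"
  proof (rule integral_le)
    fix y assume y: "y \<in> {a..b}"
    then have "(g y - g a)\<^sup>2 \<le> G y * (A y - A a)"
      using cs by simp
    also have "\<dots> \<le> G y * A y"
      using G0 Aa by (intro mult_left_mono) auto
    finally show "(g y - g a)\<^sup>2 * p y \<le> A y * p y * G y"
      using p0[of y] by (simp add: mult.commute mult.left_commute mult_left_mono less_imp_le)
  qed (intro integrable_continuous_real continuous_intros cp cA cG cg)+
  with 1 show ?thesis by linarith
qed

text \<open>Think of \<open>p\<close> as \<open>exp (- U)\<close> with \<open>U' = A\<close> and
  \<open>U'' = k > 0\<close>. The center is \<open>c = g s\<close>, where \<open>s\<close> minimizes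
  \<open>U\<close> on \<open>{a..b}\<close>: either \<open>A s = 0\<close> or \<open>s\<close> is an
  end point at which \<open>A\<close> has the right sign. The preceding one-sided bound applies on
  \<open>{s..b}\<close> and, reflected, on \<open>{a..s}\<close>.\<close>

lemma brascamp_lieb_interval:
  fixes A g p h k :: "real \<Rightarrow> real"
  assumes "a \<le> b"
    and A: "\<And>x. (A has_real_derivative k x) (at x)"
    and g: "\<And>x. (g has_real_derivative h x) (at x)"
    and p: "\<And>x. (p has_real_derivative - (A x * p x)) (at x)"
    and k: "\<And>x. k x > 0" and p0: "\<And>x. p x > 0"
    and ch: "continuous_on UNIV h" and ck: "continuous_on UNIV k"
  shows "\<exists>c. integral {a..b} (\<lambda>x. (g x - c)\<^sup>2 * p x) \<le> integral {a..b} (\<lambda>x. (h x)\<^sup>2 / k x * p x)"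
proof -
  have cA: "continuous_on S A" and cg: "continuous_on S g" and cp: "continuous_on S p" for S
    using A g p by (meson DERIV_isCont continuous_at_imp_continuous_on)+
  have ch': "continuous_on S h" and ck': "continuous_on S k" for S
    using ch ck continuous_on_subset by blast+
  have k0: "k x \<noteq> 0" for x
    using k[of x] by simp
  have right: "integral {s..b} (\<lambda>x. (g x - g s)\<^sup>2 * p x) \<le> integral {s..b} (\<lambda>x. (h x)\<^sup>2 / k x * p x)"
    if "s \<le> b" "A s \<ge> 0" for s
    by (rule integral_square_diff_le[where A = A]) (use that assms in auto)
  have left: "integral {a..s} (\<lambda>x. (g x - g s)\<^sup>2 * p x) \<le> integral {a..s} (\<lambda>x. (h x)\<^sup>2 / k x * p x)"
    if "a \<le> s" "A s \<le> 0" for s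
  proof -
    have d: "((\<lambda>x. f (- x)) has_real_derivative - f' (- x)) (at x)"
      if "\<And>x. (f has_real_derivative f' x) (at x)" for f f' :: "real \<Rightarrow> real" and x
      using DERIV_chain2[OF that[of "- x"] DERIV_minus[OF DERIV_ident]] by simp
    \<comment> \<open>Reflection replaces \<open>A\<close> by \<open>- A (- x)\<close>, which is
      again increasing and is nonnegative at \<open>- s\<close>, the left end point of the reflected
      interval.\<close>
    have "integral {-s..-a} (\<lambda>x. (g (- x) - g (- (- s)))\<^sup>2 * p (- x))
        \<le> integral {-s..-a} (\<lambda>x. (- h (- x))\<^sup>2 / k (- x) * p (- x))"
    proof (rule integral_square_diff_le[where A = "\<lambda>x. - A (- x)" and g = "\<lambda>x. g (- x)"])
      show "((\<lambda>x. - A (- x)) has_real_derivative k (- x)) (at x)" for x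
        using DERIV_minus[OF d[OF A]] by simp
      show "((\<lambda>x. p (- x)) has_real_derivative - (- A (- x) * p (- x))) (at x)" for x
        using d[OF p, of x] by simp
      show "continuous_on UNIV (\<lambda>x. - h (- x))"
        by (intro continuous_intros continuous_on_compose2[OF ch]) auto
      show "continuous_on UNIV (\<lambda>x. k (- x))"
        by (intro continuous_on_compose2[OF ck] continuous_intros) auto
    qed (use that d[OF g] k p0 in auto)
    then show ?thesis
      using Henstock_Kurzweil_Integration.integral_reflect_real[of s a "\<lambda>x. (g x - g s)\<^sup>2 * p x"]
        Henstock_Kurzweil_Integration.integral_reflect_real[of s a "\<lambda>x. (h x)\<^sup>2 / k x * p x"] by simp
  qed
  show ?thesis
  proof (cases "A a \<ge> 0 \<or> A b \<le> 0")
    case True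
    then show ?thesis
      using left[of b] right[of a] \<open>a \<le> b\<close> by blast
  next
    case False
    then obtain s where s: "a \<le> s" "s \<le> b" "A s = 0"
      using IVT'[of A a 0 b] cA \<open>a \<le> b\<close> by force
    have int: "(\<lambda>x. (g x - g s)\<^sup>2 * p x) integrable_on {a..b}"
      "(\<lambda>x. (h x)\<^sup>2 / k x * p x) integrable_on {a..b}"
      by (intro integrable_continuous_real continuous_intros cp cg ch' ck'; simp add: k0)+
    show ?thesis
      using left[of s] right[of s] s
        Henstock_Kurzweil_Integration.integral_combine[OF s(1,2) int(1)]
        Henstock_Kurzweil_Integration.integral_combine[OF s(1,2) int(2)]
      by (intro exI[of _ "g s"]) simp
  qed
qed

section \<open>Integrals over boxes\<close>

text \<open>Off \<open>I\<close> an extensional function takes the single value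
  \<open>undefined\<close>, so the set is a product over all indices with singleton factors there,
  and Tychonoff's theorem applies.\<close>

lemma compact_PiE:
  fixes S :: "'a \<Rightarrow> 'b::topological_space set"
  assumes "\<And>i. i \<in> I \<Longrightarrow> compact (S i)"
  shows "compact (PiE I S)"
proof -
  have "PiE I S = PiE UNIV (\<lambda>i. if i \<in> I then S i else {undefined})"
    by (auto simp: PiE_iff extensional_def split: if_splits)
  moreover have "compactin (product_topology (\<lambda>_. euclidean) UNIV) (PiE UNIV (\<lambda>i. if i \<in> I then S i else {undefined}))"
    unfolding compactin_PiE using assms by auto
  ultimately show ?thesis
    by (simp add: euclidean_product_topology)
qed

text \<open>Coordinates off \<open>I\<close> are constant on the space of the measure, so the
  inclusion into the full function space is coordinatewise measurable, hence Borel for the product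
  topology over a countable index type.\<close>

lemma borel_measurable_PiM_continuous:
  fixes u :: "('a::countable \<Rightarrow> real) \<Rightarrow> real"
  assumes "continuous_on UNIV u"
  shows "u \<in> borel_measurable (Pi\<^sub>M I (\<lambda>_. lborel))"
proof -
  have "(\<lambda>x. x i) \<in> borel_measurable (Pi\<^sub>M I (\<lambda>_. lborel :: real measure))" for i
  proof (cases "i \<in> I")
    case True
    then show ?thesis by measurable
  next
    case False
    have "(\<lambda>x. x i) \<in> borel_measurable (Pi\<^sub>M I (\<lambda>_. lborel :: real measure)) \<longleftrightarrow>
      (\<lambda>x. undefined :: real) \<in> borel_measurable (Pi\<^sub>M I (\<lambda>_. lborel :: real measure))"
      by (intro measurable_cong) (use False in \<open>auto simp: space_PiM PiE_iff extensional_def\<close>)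
    then show ?thesis by simp
  qed
  then have "(\<lambda>x. x) \<in> borel_measurable (Pi\<^sub>M I (\<lambda>_. lborel :: real measure))"
    by (rule measurable_coordinatewise_then_product)
  from measurable_compose[OF this borel_measurable_continuous_onI[OF assms]] show ?thesis
    by simp
qed

lemma continuous_on_fun_upd:
  fixes u :: "('a \<Rightarrow> 'b::topological_space) \<Rightarrow> 'c::topological_space"
  assumes "continuous_on UNIV u"
  shows "continuous_on UNIV (\<lambda>x. u (x(i := t)))"
proof (rule continuous_on_compose2[OF assms])
  show "continuous_on UNIV (\<lambda>x. x(i := t))"
  proof (rule continuous_on_coordinatewise_then_product)
    show "continuous_on UNIV (\<lambda>x. (x(i := t)) j)" for j
      by (cases "j = i") auto
  qed
qed simp

lemma continuous_on_fun_upd_value: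
  fixes u :: "('a \<Rightarrow> 'b::topological_space) \<Rightarrow> 'c::topological_space"
  assumes "continuous_on UNIV u"
  shows "continuous_on UNIV (\<lambda>t. u (x(i := t)))"
proof (rule continuous_on_compose2[OF assms])
  show "continuous_on UNIV (\<lambda>t. x(i := t))"
  proof (rule continuous_on_coordinatewise_then_product)
    show "continuous_on UNIV (\<lambda>t. (x(i := t)) j)" for j
      by (cases "j = i") auto
  qed
qed simp

lemma convergent_range_bounded:
  fixes X :: "nat \<Rightarrow> real"
  assumes "X \<longlonglongrightarrow> a"
  obtains D where "\<bar>a\<bar> \<le> D" "\<And>n. \<bar>X n\<bar> \<le> D"
proof -
  obtain D where "\<And>n. \<bar>X n\<bar> \<le> D"
    using convergent_imp_bounded[OF assms] by (auto simp: bounded_iff)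
  then show thesis
    by (intro that[of "max D \<bar>a\<bar>"]) (auto intro: max.coboundedI1)
qed

text \<open>The condition \<open>small\<close> is equivalent to \<open>lam > 1\<close> for the
  \<open>lam\<close> introduced below. Then the matrix with diagonal \<open>lam\<close> and
  off-diagonal \<open>1\<close> has all its eigenvalues at least \<open>lam - 1 > 0\<close>, in
  every dimension.\<close>

locale site_density =
  fixes F :: "real \<Rightarrow> real" and r eps :: real
  assumes F_cont: "continuous_on UNIV F" and F_bound: "\<And>u. \<bar>F u\<bar> \<le> eps" and r_pos: "r > 0"
    and small: "exp (2 * eps) < 2"
begin

text \<open>The cutoff belongs to the weight and not to the domain: integrals run over the whole
  product space, but only values on the compact box count, so every continuous function is
  integrable.\<close>

definition site :: "real \<Rightarrow> real" where
  "site t = indicator {-r..r} t * exp (- V F t)"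

definition box_int :: "nat set \<Rightarrow> ((nat \<Rightarrow> real) \<Rightarrow> real) \<Rightarrow> real" where
  "box_int I u = (\<integral>x. u x * (\<Prod>i\<in>I. site (x i)) \<partial>Pi\<^sub>M I (\<lambda>_. lborel))"

abbreviation box :: "nat set \<Rightarrow> (nat \<Rightarrow> real) set" where
  "box I \<equiv> PiE I (\<lambda>_. {-r..r})"

sublocale product_sigma_finite "\<lambda>_::nat. lborel :: real measure"
  by (simp add: product_sigma_finite_def lborel.sigma_finite_measure_axioms)

lemma exp_neg_V_continuous: "continuous_on S (\<lambda>t. exp (- V F t))"
  unfolding V_def by (intro continuous_intros continuous_on_subset[OF F_cont]) auto

lemma site_measurable [measurable]: "site \<in> borel_measurable borel"
proof -
  have "(\<lambda>t. exp (- V F t)) \<in> borel_measurable borel"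
    by (intro borel_measurable_continuous_onI exp_neg_V_continuous)
  then show ?thesis unfolding site_def[abs_def] by measurable
qed

lemma site_nonneg: "site t \<ge> 0"
  by (simp add: site_def)

lemma site_integrable: "integrable lborel site"
  using borel_integrable_atLeastAtMost'[OF exp_neg_V_continuous, of "-r" r]
  by (simp add: set_integrable_def site_def[abs_def] mult.commute)

lemma site_integral_pos: "integral\<^sup>L lborel site > 0"
proof -
  have "integral\<^sup>L lborel site = integral {-r..r} (\<lambda>t. exp (- V F t))"
    using set_borel_integral_eq_integral(2)[OF borel_integrable_atLeastAtMost'[OF exp_neg_V_continuous, of "-r" r]]
    by (simp add: set_lebesgue_integral_def site_def[abs_def])
  moreover have "integral {-r..r} (\<lambda>t. exp (- V F t)) \<noteq> 0"
  proof
    assume "integral {-r..r} (\<lambda>t. exp (- V F t)) = 0"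
    then have "((\<lambda>t. exp (- V F t)) has_integral 0) (cbox (-r) r)"
      using integrable_continuous_real[OF exp_neg_V_continuous, of "-r" r] by (simp add: has_integral_iff)
    from has_integral_0_cbox_imp_0[OF exp_neg_V_continuous _ this, of 0] show False
      using r_pos by auto
  qed
  moreover have "integral {-r..r} (\<lambda>t. exp (- V F t)) \<ge> 0"
    by (intro integral_nonneg integrable_continuous_real exp_neg_V_continuous) auto
  ultimately show ?thesis by linarith
qed

lemma prod_site_integrable:
  "finite (I :: nat set) \<Longrightarrow> integrable (Pi\<^sub>M I (\<lambda>_. lborel)) (\<lambda>x. \<Prod>i\<in>I. site (x i))"
  by (intro product_integrable_prod site_integrable)

lemma prod_site_eq_0:
  assumes "finite I" "x \<in> extensional I" "x \<notin> box I"
  shows "(\<Prod>i\<in>I. site (x i)) = 0"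
proof -
  obtain i where "i \<in> I" "x i \<notin> {-r..r}"
    using assms(2,3) by (auto simp: PiE_iff)
  then show ?thesis
    using assms(1) by (intro prod_zero bexI[of _ i]) (auto simp: site_def)
qed

lemma prod_site_nonneg: "(\<Prod>i\<in>I. site (x i)) \<ge> 0"
  by (intro prod_nonneg site_nonneg)

lemma box_integrable:
  fixes u :: "(nat \<Rightarrow> real) \<Rightarrow> real"
  assumes "finite I" "continuous_on UNIV u"
  shows "integrable (Pi\<^sub>M I (\<lambda>_. lborel)) (\<lambda>x. u x * (\<Prod>i\<in>I. site (x i)))"
proof -
  have "bounded (u ` box I)"
    by (intro compact_imp_bounded compact_continuous_image compact_PiE
        continuous_on_subset[OF assms(2)]) auto
  then obtain C where C: "\<And>x. x \<in> box I \<Longrightarrow> \<bar>u x\<bar> \<le> C"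
    by (auto simp: bounded_iff)
  show ?thesis
  proof (rule Bochner_Integration.integrable_bound[OF integrable_mult_right[OF prod_site_integrable[OF assms(1)], of C]])
    note borel_measurable_PiM_continuous[OF assms(2), measurable]
    show "(\<lambda>x. u x * (\<Prod>i\<in>I. site (x i))) \<in> borel_measurable (Pi\<^sub>M I (\<lambda>_. lborel))"
      by measurable
    show "AE x in Pi\<^sub>M I (\<lambda>_. lborel). norm (u x * (\<Prod>i\<in>I. site (x i))) \<le> norm (C * (\<Prod>i\<in>I. site (x i)))"
    proof (intro AE_I2)
      fix x assume "x \<in> space (Pi\<^sub>M I (\<lambda>_. lborel :: real measure))"
      then have x: "x \<in> extensional I" by (simp add: space_PiM PiE_iff)
      show "norm (u x * (\<Prod>i\<in>I. site (x i))) \<le> norm (C * (\<Prod>i\<in>I. site (x i)))"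
      proof (cases "x \<in> box I")
        case True
        then show ?thesis using C[OF True] by (simp add: abs_mult mult_right_mono)
      qed (simp add: prod_site_eq_0[OF assms(1) x])
    qed
  qed
qed

text \<open>The slices with parameter in \<open>{-D..D}\<close> fill a compact set, so one constant
  dominates them all; the limits under the integral below need this uniformity.\<close>

lemma slice_bounded:
  fixes u :: "(nat \<Rightarrow> real) \<Rightarrow> real"
  assumes "i \<notin> I" "continuous_on UNIV u"
  obtains C where "\<And>x s. x \<in> box I \<Longrightarrow> \<bar>s\<bar> \<le> D \<Longrightarrow> \<bar>u (x(i := s))\<bar> \<le> C"
proof -
  let ?K = "PiE (insert i I) (\<lambda>j. if j = i then {-D..D} else {-r..r})"
  have "bounded (u ` ?K)"
    by (intro compact_imp_bounded compact_continuous_image compact_PiE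
        continuous_on_subset[OF assms(2)]) auto
  then obtain C where C: "\<And>x. x \<in> ?K \<Longrightarrow> \<bar>u x\<bar> \<le> C"
    by (auto simp: bounded_iff)
  show thesis
    by (rule that[of C], rule C) (use assms(1) in \<open>auto simp: PiE_iff extensional_def\<close>)
qed

lemma box_integral_tendsto:
  assumes I: "finite I" and u: "\<And>n. continuous_on UNIV (u n)" "continuous_on UNIV v"
    and lim: "\<And>x. x \<in> box I \<Longrightarrow> (\<lambda>n. u n x) \<longlonglongrightarrow> v x"
    and C: "\<And>n x. x \<in> box I \<Longrightarrow> \<bar>u n x\<bar> \<le> C"
  shows "(\<lambda>n. box_int I (u n)) \<longlonglongrightarrow> box_int I v"
  unfolding box_int_def
proof (rule integral_dominated_convergence)
  show "integrable (Pi\<^sub>M I (\<lambda>_. lborel)) (\<lambda>x. C * (\<Prod>i\<in>I. site (x i)))"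
    by (intro integrable_mult_right prod_site_integrable I)
  note u[THEN borel_measurable_PiM_continuous, measurable]
  show "(\<lambda>x. v x * (\<Prod>i\<in>I. site (x i))) \<in> borel_measurable (Pi\<^sub>M I (\<lambda>_. lborel))"
    by measurable
  show "(\<lambda>x. u n x * (\<Prod>i\<in>I. site (x i))) \<in> borel_measurable (Pi\<^sub>M I (\<lambda>_. lborel))" for n
    by measurable
  have ext: "x \<in> extensional I" if "x \<in> space (Pi\<^sub>M I (\<lambda>_. lborel :: real measure))" for x
    using that by (simp add: space_PiM PiE_iff)
  show "AE x in Pi\<^sub>M I (\<lambda>_. lborel). norm (u n x * (\<Prod>i\<in>I. site (x i))) \<le> C * (\<Prod>i\<in>I. site (x i))" for n
  proof (intro AE_I2)
    fix x assume x: "x \<in> space (Pi\<^sub>M I (\<lambda>_. lborel :: real measure))"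
    show "norm (u n x * (\<Prod>i\<in>I. site (x i))) \<le> C * (\<Prod>i\<in>I. site (x i))"
    proof (cases "x \<in> box I")
      case True
      then show ?thesis
        using mult_right_mono[OF C[OF True] prod_site_nonneg] prod_site_nonneg[of x I] by (simp add: abs_mult)
    qed (simp add: prod_site_eq_0[OF I ext[OF x]])
  qed
  show "AE x in Pi\<^sub>M I (\<lambda>_. lborel). (\<lambda>n. u n x * (\<Prod>i\<in>I. site (x i))) \<longlonglongrightarrow> v x * (\<Prod>i\<in>I. site (x i))"
  proof (intro AE_I2)
    fix x assume x: "x \<in> space (Pi\<^sub>M I (\<lambda>_. lborel :: real measure))"
    show "(\<lambda>n. u n x * (\<Prod>i\<in>I. site (x i))) \<longlonglongrightarrow> v x * (\<Prod>i\<in>I. site (x i))"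
    proof (cases "x \<in> box I")
      case True
      then show ?thesis
        by (intro tendsto_mult tendsto_const lim)
    qed (simp add: prod_site_eq_0[OF I ext[OF x]])
  qed
qed

lemma box_int_slice_continuous:
  assumes I: "finite I" "i \<notin> I" and u: "continuous_on UNIV u"
  shows "continuous_on UNIV (\<lambda>t. box_int I (\<lambda>x. u (x(i := t))))"
proof (rule continuous_on_sequentiallyI)
  fix X :: "nat \<Rightarrow> real" and a assume X: "X \<longlonglongrightarrow> a"
  then obtain D where D: "\<bar>a\<bar> \<le> D" "\<And>n. \<bar>X n\<bar> \<le> D"
    by (rule convergent_range_bounded) blast
  obtain C where C: "\<And>x s. x \<in> box I \<Longrightarrow> \<bar>s\<bar> \<le> D \<Longrightarrow> \<bar>u (x(i := s))\<bar> \<le> C"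
    by (rule slice_bounded[OF I(2) u, of D]) blast
  show "(\<lambda>n. box_int I (\<lambda>x. u (x(i := X n)))) \<longlonglongrightarrow> box_int I (\<lambda>x. u (x(i := a)))"
  proof (rule box_integral_tendsto[OF I(1)])
    show "(\<lambda>n. u (x(i := X n))) \<longlonglongrightarrow> u (x(i := a))" for x
      using continuous_on_fun_upd_value[OF u, of x i] X
      by (auto simp: continuous_on_sequentially comp_def)
    show "\<bar>u (x(i := X n))\<bar> \<le> C" if "x \<in> box I" for n x
      using C[OF that D(2)] .
  qed (intro continuous_on_fun_upd u)+
qed

text \<open>Along any sequence tending to \<open>t\<close> the difference quotients are bounded by a
  bound for \<open>u'\<close> on a compact set (mean value inequality), so dominated convergence
  moves the limit under the integral.\<close>

lemma box_int_slice_deriv: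
  assumes I: "finite I" "i \<notin> I" and u: "continuous_on UNIV u" and u': "continuous_on UNIV u'"
    and d: "\<And>x. ((\<lambda>t. u (x(i := t))) has_real_derivative u' x) (at (x i))"
  shows "((\<lambda>t. box_int I (\<lambda>x. u (x(i := t)))) has_real_derivative box_int I (\<lambda>x. u' (x(i := t)))) (at t)"
  unfolding has_field_derivative_iff tendsto_at_iff_sequentially
proof (intro allI impI)
  fix X :: "nat \<Rightarrow> real" assume X0: "\<forall>n. X n \<in> UNIV - {t}" and X: "X \<longlonglongrightarrow> t"
  obtain D where D: "\<bar>t\<bar> \<le> D" "\<And>n. \<bar>X n\<bar> \<le> D"
    using X by (rule convergent_range_bounded) blast
  obtain C where C: "\<And>x s. x \<in> box I \<Longrightarrow> \<bar>s\<bar> \<le> D \<Longrightarrow> \<bar>u' (x(i := s))\<bar> \<le> C"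
    by (rule slice_bounded[OF I(2) u', of D]) blast
  have d': "((\<lambda>t. u (x(i := t))) has_real_derivative u' (x(i := s))) (at s)" for x s
    using d[of "x(i := s)"] by simp
  define q where "q n x = (u (x(i := X n)) - u (x(i := t))) / (X n - t)" for n x
  have "(\<lambda>n. box_int I (q n)) \<longlonglongrightarrow> box_int I (\<lambda>x. u' (x(i := t)))"
  proof (rule box_integral_tendsto[OF I(1)])
    show "continuous_on UNIV (q n)" for n
      unfolding q_def using X0 by (intro continuous_intros continuous_on_fun_upd u) auto
    show "continuous_on UNIV (\<lambda>x. u' (x(i := t)))"
      by (intro continuous_on_fun_upd u')
    show "(\<lambda>n. q n x) \<longlonglongrightarrow> u' (x(i := t))" for x
      using d'[of x t] X0 X
      by (auto simp: has_field_derivative_iff tendsto_at_iff_sequentially comp_def q_def)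
    show "\<bar>q n x\<bar> \<le> C" if x: "x \<in> box I" for n x
    proof -
      have "norm (u (x(i := X n)) - u (x(i := t))) \<le> C * norm (X n - t)"
      proof (rule field_differentiable_bound)
        show "convex {-D..D}" by simp
        show "((\<lambda>t. u (x(i := t))) has_field_derivative u' (x(i := s))) (at s within {-D..D})" for s
          using d' by (rule DERIV_subset) simp
      qed (use C[OF x] D in \<open>auto simp: abs_le_iff minus_le_iff\<close>)
      then show ?thesis
        using X0 by (simp add: q_def abs_divide divide_simps)
    qed
  qed
  moreover have "box_int I (q n) = (box_int I (\<lambda>x. u (x(i := X n))) - box_int I (\<lambda>x. u (x(i := t)))) / (X n - t)" for n
  proof -
    have "box_int I (q n) = (\<integral>x. (u (x(i := X n)) * (\<Prod>i\<in>I. site (x i)) - u (x(i := t)) * (\<Prod>i\<in>I. site (x i))) / (X n - t)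
        \<partial>Pi\<^sub>M I (\<lambda>_. lborel))"
      unfolding box_int_def q_def by (simp add: left_diff_distrib)
    also have "\<dots> = (box_int I (\<lambda>x. u (x(i := X n))) - box_int I (\<lambda>x. u (x(i := t)))) / (X n - t)"
      unfolding box_int_def
      by (subst integral_divide_zero, subst Bochner_Integration.integral_diff)
        (intro box_integrable I continuous_on_fun_upd u refl)+
    finally show ?thesis .
  qed
  ultimately show "((\<lambda>y. (box_int I (\<lambda>x. u (x(i := y))) - box_int I (\<lambda>x. u (x(i := t)))) / (y - t)) \<circ> X)
      \<longlonglongrightarrow> box_int I (\<lambda>x. u' (x(i := t)))"
    by (simp add: comp_def)
qed

text \<open>Fubini for the splitting of \<open>insert i I\<close> into \<open>{i}\<close> and
  \<open>I\<close>; the outer integrand is measurable because the slice integrals depend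
  continuously on \<open>t\<close>.\<close>

lemma box_int_insert:
  assumes I: "finite I" "i \<notin> I" and u: "continuous_on UNIV u"
  shows "box_int (insert i I) u = (\<integral>t. site t * box_int I (\<lambda>x. u (x(i := t))) \<partial>lborel)"
proof -
  let ?f = "\<lambda>x. u x * (\<Prod>j\<in>insert i I. site (x j))"
  have int: "integrable (Pi\<^sub>M ({i} \<union> I) (\<lambda>_. lborel)) ?f"
    using box_integrable[of "insert i I" u] I u by simp
  have "box_int (insert i I) u = integral\<^sup>L (Pi\<^sub>M ({i} \<union> I) (\<lambda>_. lborel)) ?f"
    by (simp add: box_int_def)
  also have "\<dots> = (\<integral>z. (\<integral>y. ?f (merge {i} I (z, y)) \<partial>Pi\<^sub>M I (\<lambda>_. lborel)) \<partial>Pi\<^sub>M {i} (\<lambda>_. lborel))"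
    using I int by (intro product_integral_fold) auto
  also have "\<dots> = (\<integral>z. site (z i) * box_int I (\<lambda>x. u (x(i := z i))) \<partial>Pi\<^sub>M {i} (\<lambda>_. lborel))"
  proof (intro Bochner_Integration.integral_cong refl)
    fix z :: "nat \<Rightarrow> real" assume "z \<in> space (Pi\<^sub>M {i} (\<lambda>_. lborel :: real measure))"
    have "(\<integral>y. ?f (merge {i} I (z, y)) \<partial>Pi\<^sub>M I (\<lambda>_. lborel)) =
          (\<integral>y. site (z i) * (u (y(i := z i)) * (\<Prod>j\<in>I. site (y j))) \<partial>Pi\<^sub>M I (\<lambda>_. lborel))"
    proof (intro Bochner_Integration.integral_cong refl)
      fix y :: "nat \<Rightarrow> real" assume y: "y \<in> space (Pi\<^sub>M I (\<lambda>_. lborel :: real measure))"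
      have "merge {i} I (z, y) = y(i := z i)"
        using y I by (auto simp: merge_def fun_eq_iff space_PiM PiE_iff extensional_def)
      moreover have "(\<Prod>j\<in>I. site ((y(i := z i)) j)) = (\<Prod>j\<in>I. site (y j))"
        using I by (intro prod.cong) auto
      ultimately show "?f (merge {i} I (z, y)) = site (z i) * (u (y(i := z i)) * (\<Prod>j\<in>I. site (y j)))"
        using I by simp
    qed
    then show "(\<integral>y. ?f (merge {i} I (z, y)) \<partial>Pi\<^sub>M I (\<lambda>_. lborel)) = site (z i) * box_int I (\<lambda>x. u (x(i := z i)))"
      by (simp add: box_int_def)
  qed
  also have "\<dots> = (\<integral>t. site t * box_int I (\<lambda>x. u (x(i := t))) \<partial>lborel)"
  proof (rule product_integral_singleton)
    have "(\<lambda>t. box_int I (\<lambda>x. u (x(i := t)))) \<in> borel_measurable borel"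
      by (intro borel_measurable_continuous_onI box_int_slice_continuous I u)
    then show "(\<lambda>t. site t * box_int I (\<lambda>x. u (x(i := t)))) \<in> borel_measurable lborel"
      by measurable
  qed
  finally show ?thesis .
qed

lemma box_int_add:
  "finite I \<Longrightarrow> continuous_on UNIV u \<Longrightarrow> continuous_on UNIV v \<Longrightarrow>
    box_int I (\<lambda>x. u x + v x) = box_int I u + box_int I v"
  unfolding box_int_def
  by (subst Bochner_Integration.integral_add[symmetric]) (auto intro: box_integrable simp: distrib_right)

lemma box_int_cmult: "box_int I (\<lambda>x. c * u x) = c * box_int I u"
  by (simp add: box_int_def mult.assoc)

lemma box_int_mono:
  "finite I \<Longrightarrow> continuous_on UNIV u \<Longrightarrow> continuous_on UNIV v \<Longrightarrow> (\<And>x. u x \<le> v x) \<Longrightarrow>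
    box_int I u \<le> box_int I v"
  unfolding box_int_def
  by (intro integral_mono box_integrable mult_right_mono prod_site_nonneg) auto

lemma box_int_pos:
  assumes "finite I" "continuous_on UNIV u" "\<And>x. u x > 0"
  shows "box_int I u > 0"
proof -
  have "compact (u ` box I)"
    by (intro compact_continuous_image compact_PiE continuous_on_subset[OF assms(2)]) auto
  moreover have "box I \<noteq> {}"
    using r_pos by (auto simp: PiE_eq_empty_iff)
  ultimately obtain z where z: "\<And>x. x \<in> box I \<Longrightarrow> u z \<le> u x"
    using compact_attains_inf[of "u ` box I"] by fastforce
  have "0 < u z * (\<Prod>i\<in>I. integral\<^sup>L lborel site)"
    using assms(3) site_integral_pos by (simp add: prod_pos)
  also have "\<dots> = box_int I (\<lambda>x. u z * 1)"
    using product_integral_prod[OF assms(1) site_integrable] unfolding box_int_cmult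
    by (simp add: box_int_def)
  also have "\<dots> \<le> box_int I u"
    unfolding box_int_def
  proof (intro integral_mono box_integrable assms continuous_intros)
    fix x assume "x \<in> space (Pi\<^sub>M I (\<lambda>_. lborel :: real measure))"
    then have x: "x \<in> extensional I" by (simp add: space_PiM PiE_iff)
    show "u z * 1 * (\<Prod>i\<in>I. site (x i)) \<le> u x * (\<Prod>i\<in>I. site (x i))"
    proof (cases "x \<in> box I")
      case True
      then show ?thesis using z[OF True] by (intro mult_right_mono prod_site_nonneg) auto
    qed (simp add: prod_site_eq_0[OF assms(1) x])
  qed
  finally show ?thesis .
qed

end

section \<open>Conditional means and their derivatives\<close>

text \<open>The quadratic part of the factor \<open>exp (- V F (M - S))\<close>. The other part,
  with \<open>F (M - S)\<close>, is left out here and restored through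
  \<open>weight_bounds\<close>.\<close>

definition gauss :: "nat set \<Rightarrow> real \<Rightarrow> (nat \<Rightarrow> real) \<Rightarrow> real" where
  "gauss I M x = exp (- (M - (\<Sum>i\<in>I. x i))\<^sup>2 / 2)"

lemma sum_coord_continuous: "continuous_on UNIV (\<lambda>x. \<Sum>i\<in>I. x i :: real)"
  by (intro continuous_on_sum continuous_on_product_coordinates)

lemma gauss_continuous: "continuous_on UNIV (gauss I M)"
  unfolding gauss_def[abs_def] by (intro continuous_intros sum_coord_continuous) auto

text \<open>What makes the induction possible: conditioning on \<open>x i = t\<close> stays within
  the family and only moves \<open>M\<close> to \<open>M - t\<close>. This is why the induction
  hypothesis has to hold for all \<open>M\<close>.\<close>

lemma gauss_insert: "finite I \<Longrightarrow> i \<notin> I \<Longrightarrow> gauss (insert i I) M (x(i := t)) = gauss I (M - t) x"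
proof -
  assume "finite I" "i \<notin> I"
  moreover from this have "(\<Sum>j\<in>I. (x(i := t)) j) = (\<Sum>j\<in>I. x j)"
    by (intro sum.cong) auto
  ultimately show ?thesis by (simp add: gauss_def diff_diff_eq)
qed

context site_density
begin

definition gint :: "nat set \<Rightarrow> real \<Rightarrow> ((nat \<Rightarrow> real) \<Rightarrow> real) \<Rightarrow> real" where
  "gint I M u = box_int I (\<lambda>x. u x * gauss I M x)"

definition mean :: "nat set \<Rightarrow> real \<Rightarrow> ((nat \<Rightarrow> real) \<Rightarrow> real) \<Rightarrow> real" where
  "mean I M u = gint I M u / gint I M (\<lambda>_. 1)"

lemma gint_pos: "finite I \<Longrightarrow> gint I M (\<lambda>_. 1) > 0"
  unfolding gint_def by (intro box_int_pos continuous_intros gauss_continuous) (auto simp: gauss_def)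

lemma gint_add:
  "finite I \<Longrightarrow> continuous_on UNIV u \<Longrightarrow> continuous_on UNIV v \<Longrightarrow>
    gint I M (\<lambda>x. u x + v x) = gint I M u + gint I M v"
  unfolding gint_def distrib_right by (intro box_int_add continuous_intros gauss_continuous)

lemma gint_cmult: "gint I M (\<lambda>x. c * u x) = c * gint I M u"
  unfolding gint_def mult.assoc by (rule box_int_cmult)

lemma mean_add:
  "finite I \<Longrightarrow> continuous_on UNIV u \<Longrightarrow> continuous_on UNIV v \<Longrightarrow>
    mean I M (\<lambda>x. u x + v x) = mean I M u + mean I M v"
  by (simp add: mean_def gint_add add_divide_distrib)

lemma mean_cmult: "mean I M (\<lambda>x. c * u x) = c * mean I M u"
  by (simp add: mean_def gint_cmult)

lemma mean_diff:
  assumes "finite I" "continuous_on UNIV u" "continuous_on UNIV v"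
  shows "mean I M (\<lambda>x. u x - v x) = mean I M u - mean I M v"
  using mean_add[OF assms(1,2) continuous_on_mult_left[OF assms(3)], of M "-1"] mean_cmult[of I M "-1" v]
  by simp

lemma mean_const: "finite I \<Longrightarrow> mean I M (\<lambda>_. c) = c"
  using gint_pos[of I M] gint_cmult[of I M c "\<lambda>_. 1"] by (simp add: mean_def)

lemma mean_mono:
  assumes "finite I" "continuous_on UNIV u" "continuous_on UNIV v" "\<And>x. u x \<le> v x"
  shows "mean I M u \<le> mean I M v"
  unfolding mean_def gint_def
proof (intro divide_right_mono box_int_mono assms continuous_intros gauss_continuous mult_right_mono)
  show "0 \<le> box_int I (\<lambda>x. 1 * gauss I M x)"
    using gint_pos[OF assms(1), of M] by (simp add: gint_def)
qed (simp add: gauss_def)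

definition variance :: "nat set \<Rightarrow> real \<Rightarrow> ((nat \<Rightarrow> real) \<Rightarrow> real) \<Rightarrow> real" where
  "variance I M u = mean I M (\<lambda>x. (u x)\<^sup>2) - (mean I M u)\<^sup>2"

definition covariance :: "nat set \<Rightarrow> real \<Rightarrow> ((nat \<Rightarrow> real) \<Rightarrow> real) \<Rightarrow> ((nat \<Rightarrow> real) \<Rightarrow> real) \<Rightarrow> real" where
  "covariance I M u v = mean I M (\<lambda>x. u x * v x) - mean I M u * mean I M v"

lemma variance_diff_cmult:
  assumes "finite I" "continuous_on UNIV u" "continuous_on UNIV v"
  shows "variance I M (\<lambda>x. u x - s * v x) = variance I M u - 2 * s * covariance I M u v + s\<^sup>2 * variance I M v"
proof -
  have 1: "(\<lambda>x. (u x - s * v x)\<^sup>2) = (\<lambda>x. (u x)\<^sup>2 + ((- 2 * s) * (u x * v x) + s\<^sup>2 * (v x)\<^sup>2))"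
    by (auto simp: power2_eq_square algebra_simps)
  have "mean I M (\<lambda>x. (u x - s * v x)\<^sup>2) =
      mean I M (\<lambda>x. (u x)\<^sup>2) + ((- 2 * s) * mean I M (\<lambda>x. u x * v x) + s\<^sup>2 * mean I M (\<lambda>x. (v x)\<^sup>2))"
    unfolding 1 using assms by (simp only: mean_add mean_cmult continuous_intros)
  moreover have "mean I M (\<lambda>x. u x - s * v x) = mean I M u - s * mean I M v"
    using assms by (simp only: mean_diff mean_cmult continuous_intros)
  ultimately show ?thesis
    unfolding variance_def covariance_def by (simp only:) (simp add: power2_eq_square algebra_simps)
qed

lemma variance_nonneg:
  assumes "finite I" "continuous_on UNIV u"
  shows "variance I M u \<ge> 0"
proof -
  have "0 = mean I M (\<lambda>_. 0)" using assms by (simp add: mean_const)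
  \<comment> \<open>The factor \<open>1\<close> is the constant function to which
    \<open>variance_diff_cmult\<close> is applied as \<open>v\<close>.\<close>
  also have "\<dots> \<le> mean I M (\<lambda>x. (u x - mean I M u * 1)\<^sup>2)"
    using assms by (intro mean_mono continuous_intros) auto
  also have "\<dots> = variance I M (\<lambda>x. u x - mean I M u * 1)"
    using assms by (simp add: variance_def mean_diff mean_const continuous_intros)
  also have "\<dots> = variance I M u"
    using assms by (subst variance_diff_cmult) (simp_all add: covariance_def variance_def mean_const)
  finally show ?thesis .
qed

lemma gint_slice_eq:
  assumes "finite I" "i \<notin> I"
  shows "gint I (M - t) (\<lambda>x. u (x(i := t))) =
    box_int I (\<lambda>x. (\<lambda>y. u y * gauss (insert i I) M y) (x(i := t)))"
  by (simp add: gint_def gauss_insert[OF assms])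

lemma gint_insert:
  assumes "finite I" "i \<notin> I" "continuous_on UNIV u"
  shows "gint (insert i I) M u = (\<integral>t. site t * gint I (M - t) (\<lambda>x. u (x(i := t))) \<partial>lborel)"
  unfolding gint_slice_eq[OF assms(1,2)] gint_def[of "insert i I"]
  by (intro box_int_insert continuous_intros gauss_continuous assms)

lemma gint_slice_continuous:
  assumes "finite I" "i \<notin> I" "continuous_on UNIV u"
  shows "continuous_on UNIV (\<lambda>t. gint I (M - t) (\<lambda>x. u (x(i := t))))"
  unfolding gint_slice_eq[OF assms(1,2)]
  by (intro box_int_slice_continuous continuous_intros gauss_continuous assms)

text \<open>Differentiating the Gaussian factor contributes \<open>M - t - S\<close> with
  \<open>S\<close> the sum over \<open>I\<close>, which splits into the last two terms; the first
  comes from differentiating \<open>u\<close>.\<close>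

lemma gint_slice_deriv:
  assumes I: "finite I" "i \<notin> I" and u: "continuous_on UNIV u" and u': "continuous_on UNIV u'"
    and d: "\<And>x. ((\<lambda>t. u (x(i := t))) has_real_derivative u' x) (at (x i))"
  shows "((\<lambda>t. gint I (M - t) (\<lambda>x. u (x(i := t)))) has_real_derivative
    gint I (M - t) (\<lambda>x. u' (x(i := t))) + (M - t) * gint I (M - t) (\<lambda>x. u (x(i := t)))
      - gint I (M - t) (\<lambda>x. u (x(i := t)) * (\<Sum>j\<in>I. x j))) (at t)"
proof -
  let ?g = "gauss (insert i I) M"
  let ?s = "\<lambda>x. M - (\<Sum>j\<in>insert i I. x j)"
  have S: "(\<Sum>j\<in>insert i I. (x(i := t)) j) = t + (\<Sum>j\<in>I. x j)" for x t
  proof -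
    have "(\<Sum>j\<in>I. (x(i := t)) j) = (\<Sum>j\<in>I. x j)"
      using I by (intro sum.cong) auto
    then show ?thesis using I by simp
  qed
  have "((\<lambda>t. ?g (x(i := t))) has_real_derivative ?s (x(i := t)) * ?g (x(i := t))) (at t)" for x t
    unfolding gauss_def S by (auto intro!: derivative_eq_intros simp: power2_eq_square field_simps)
  then have dg: "((\<lambda>t. ?g (x(i := t))) has_real_derivative ?s x * ?g x) (at (x i))" for x
    by (metis fun_upd_triv)
  have "((\<lambda>t. box_int I (\<lambda>x. (\<lambda>y. u y * ?g y) (x(i := t)))) has_real_derivative
      box_int I (\<lambda>x. (\<lambda>y. u' y * ?g y + ?s y * ?g y * u y) (x(i := t)))) (at t)"
  proof (rule box_int_slice_deriv[OF I])
    show "((\<lambda>t. u (x(i := t)) * ?g (x(i := t))) has_real_derivative u' x * ?g x + ?s x * ?g x * u x) (at (x i))" for x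
      using DERIV_mult[OF d[of x] dg[of x]] by simp
  qed (intro continuous_intros gauss_continuous sum_coord_continuous u u')+
  moreover have "box_int I (\<lambda>x. (\<lambda>y. u' y * ?g y + ?s y * ?g y * u y) (x(i := t))) =
     gint I (M - t) (\<lambda>x. u' (x(i := t)) + ((M - t) * u (x(i := t)) + (-1) * (u (x(i := t)) * (\<Sum>j\<in>I. x j))))"
    unfolding gint_def by (rule arg_cong[where f = "box_int I"])
      (simp only: fun_eq_iff S gauss_insert[OF I], simp add: algebra_simps)
  ultimately show ?thesis
    unfolding gint_slice_eq[OF I, symmetric] using I(1)
    by (simp only: gint_add gint_cmult continuous_intros continuous_on_fun_upd u u' sum_coord_continuous)
      (simp add: add_diff_eq)
qed

lemma mean_slice_continuous:
  assumes "finite I" "i \<notin> I" "continuous_on UNIV u"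
  shows "continuous_on UNIV (\<lambda>t. mean I (M - t) (\<lambda>x. u (x(i := t))))"
  unfolding mean_def
  using gint_slice_continuous[OF assms, of M] gint_slice_continuous[OF assms(1,2), of "\<lambda>_. 1" M]
    gint_pos[OF assms(1)]
  by (intro continuous_on_divide) (auto simp: less_le)

text \<open>The case \<open>u = 1\<close> of the preceding derivative, arranged as a logarithmic
  derivative; the drift \<open>A\<close> of the marginal in the induction step is read off from
  it.\<close>

lemma gint_one_deriv:
  assumes I: "finite I" "i \<notin> I"
  shows "((\<lambda>t. gint I (M - t) (\<lambda>_. 1)) has_real_derivative
    (M - t - mean I (M - t) (\<lambda>x. \<Sum>j\<in>I. x j)) * gint I (M - t) (\<lambda>_. 1)) (at t)"
proof -
  have 0: "gint I M (\<lambda>_. 0) = 0" for M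
    using gint_cmult[of I M 0 "\<lambda>_. 0"] by simp
  show ?thesis
    using gint_slice_deriv[OF I, of "\<lambda>_. 1" "\<lambda>_. 0" M t] gint_pos[OF I(1), of "M - t"]
    by (simp add: mean_def 0 left_diff_distrib)
qed

text \<open>In the quotient rule for \<open>gint u / gint 1\<close> the terms with
  \<open>M - t\<close> cancel, and what the Gaussian factor leaves is a covariance with the
  sum.\<close>

lemma mean_slice_deriv:
  assumes I: "finite I" "i \<notin> I" and u: "continuous_on UNIV u" and u': "continuous_on UNIV u'"
    and d: "\<And>x. ((\<lambda>t. u (x(i := t))) has_real_derivative u' x) (at (x i))"
  shows "((\<lambda>t. mean I (M - t) (\<lambda>x. u (x(i := t)))) has_real_derivative
    mean I (M - t) (\<lambda>x. u' (x(i := t))) - covariance I (M - t) (\<lambda>x. u (x(i := t))) (\<lambda>x. \<Sum>j\<in>I. x j)) (at t)"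
proof -
  have pos: "gint I (M - t) (\<lambda>_. 1) \<noteq> 0"
    using gint_pos[OF I(1), of "M - t"] by simp
  have quotient: "((n' + m * n - c) * j - n * ((m - s / j) * j)) / (j * j) = n' / j - (c / j - n / j * (s / j))"
    if "j \<noteq> 0" for n' m n c j s :: real
    using that by (simp add: field_simps)
  show ?thesis
    unfolding mean_def[abs_def] covariance_def
    by (rule DERIV_cong[OF DERIV_divide[OF gint_slice_deriv[OF I u u' d] gint_one_deriv[OF I] pos]])
      (unfold mean_def, rule quotient[OF pos])
qed

end

section \<open>The inequality on a box\<close>

text \<open>Functions live on all of \<open>nat \<Rightarrow> real\<close>, so updates and slices
  never leave the domain. The partial derivatives are passed as data \<open>D\<close>, so that
  slicing and subtraction act on them by plain formulas.\<close>

definition C1_on :: "nat set \<Rightarrow> ((nat \<Rightarrow> real) \<Rightarrow> real) \<Rightarrow> (nat \<Rightarrow> (nat \<Rightarrow> real) \<Rightarrow> real) \<Rightarrow> bool" where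
  "C1_on I u D \<longleftrightarrow> continuous_on UNIV u \<and>
    (\<forall>i\<in>I. continuous_on UNIV (D i) \<and>
      (\<forall>x. ((\<lambda>t. u (x(i := t))) has_real_derivative D i x) (at (x i))))"

lemma C1_on_slice:
  assumes "C1_on (insert i I) u D" "i \<notin> I"
  shows "C1_on I (\<lambda>x. u (x(i := t))) (\<lambda>j x. D j (x(i := t)))"
  unfolding C1_on_def
proof (intro conjI ballI allI)
  fix j x assume j: "j \<in> I"
  then have "j \<noteq> i" using assms(2) by auto
  have "((\<lambda>s. u ((x(i := t))(j := s))) has_real_derivative D j (x(i := t))) (at ((x(i := t)) j))"
    using assms(1) j unfolding C1_on_def by blast
  then show "((\<lambda>s. u ((x(j := s))(i := t))) has_real_derivative D j (x(i := t))) (at (x j))"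
    using \<open>j \<noteq> i\<close> by (simp add: fun_upd_twist)
qed (use assms(1) in \<open>auto simp: C1_on_def intro!: continuous_on_fun_upd\<close>)

lemma C1_on_sum: "finite I \<Longrightarrow> C1_on I (\<lambda>x. \<Sum>j\<in>I. x j) (\<lambda>_ _. 1)"
  unfolding C1_on_def
proof (intro conjI ballI allI)
  fix i and x :: "nat \<Rightarrow> real" assume "finite I" "i \<in> I"
  then have "(\<Sum>j\<in>I. (x(i := t)) j) = t + (\<Sum>j\<in>I - {i}. x j)" for t
    by (subst sum.remove[of I i]) (auto intro: sum.cong)
  then show "((\<lambda>t. \<Sum>j\<in>I. (x(i := t)) j) has_real_derivative 1) (at (x i))"
    by (simp only:) (auto intro!: derivative_eq_intros)
qed (auto intro: sum_coord_continuous)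

lemma C1_on_diff_cmult:
  "C1_on I u D \<Longrightarrow> C1_on I v D' \<Longrightarrow> C1_on I (\<lambda>x. u x - s * v x) (\<lambda>i x. D i x - s * D' i x)"
  unfolding C1_on_def by (auto intro!: continuous_intros derivative_eq_intros)

text \<open>The difference of the two sides is a constant times a square.\<close>
lemma schur_complement_le:
  fixes A B w s al m :: real
  assumes "al > 0" "m \<ge> 0"
  shows "(A - 2 * s * B + s\<^sup>2 * m - (B - s * m)\<^sup>2 / (al + m)) / al + (2 * s * w - s\<^sup>2 * (1 + al))
    \<le> (A + w\<^sup>2 - (B + w)\<^sup>2 / (al + (1 + m))) / al"
proof -
  define a where "a = al + m"
  define X where "X = (B + w)\<^sup>2 / (a + 1)"
  define Y where "Y = (B - s * m)\<^sup>2 / a"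
  \<comment> \<open>\<open>E\<close> is \<open>al\<close> times the right-hand side minus the
    left-hand side.\<close>
  define E where "E = w\<^sup>2 - X + 2 * s * B - s\<^sup>2 * m + Y - al * (2 * s * w - s\<^sup>2 * (1 + al))"
  have "a > 0" using assms by (simp add: a_def)
  then have "X * (a + 1) = (B + w)\<^sup>2" "Y * a = (B - s * m)\<^sup>2"
    by (simp_all add: X_def Y_def)
  then have "a * (a + 1) * E = (al * (a + 1) * s - (a * w - B))\<^sup>2"
    unfolding E_def using a_def by algebra
  then have "a * (a + 1) * E \<ge> 0" by simp
  then have "E \<ge> 0"
    using mult_le_cancel_left_pos[of "a * (a + 1)" 0 E] \<open>a > 0\<close> by simp
  then have "(A - 2 * s * B + s\<^sup>2 * m - Y) + al * (2 * s * w - s\<^sup>2 * (1 + al)) \<le> A + w\<^sup>2 - X"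
    by (simp add: E_def)
  from divide_right_mono[OF this less_imp_le[OF assms(1)]]
  have "(A - 2 * s * B + s\<^sup>2 * m - Y) / al + (2 * s * w - s\<^sup>2 * (1 + al)) \<le> (A + w\<^sup>2 - X) / al"
    using assms(1) by (simp add: add_divide_distrib)
  moreover have "al + (1 + m) = a + 1" by (simp add: a_def)
  ultimately show ?thesis
    by (simp only: X_def Y_def a_def)
qed

context site_density
begin

text \<open>The Hessian of the quadratic part of the Hamiltonian has diagonal entries
  \<open>2\<close> and off-diagonal entries \<open>1\<close>. The one-site perturbation
  \<open>F\<close> costs a factor \<open>exp (2 * eps)\<close>, which is charged to the diagonal
  entry only.\<close>

abbreviation lam :: real where "lam \<equiv> 2 * exp (- 2 * eps)"

lemma lam_gt_1: "lam > 1"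
  using small by (simp add: exp_minus divide_simps)

text \<open>With \<open>m = card I\<close> this is the quadratic form of the inverse of the \<open>m \<times> m\<close> matrix with
  diagonal entries \<open>lam\<close> and off-diagonal entries \<open>1\<close>, applied to the gradient.\<close>
definition grad_form :: "nat set \<Rightarrow> (nat \<Rightarrow> (nat \<Rightarrow> real) \<Rightarrow> real) \<Rightarrow> (nat \<Rightarrow> real) \<Rightarrow> real" where
  "grad_form I D x =
    ((\<Sum>i\<in>I. (D i x)\<^sup>2) - (\<Sum>i\<in>I. D i x)\<^sup>2 / (lam - 1 + real (card I))) / (lam - 1)"

lemma grad_form_continuous:
  "(\<And>i. i \<in> I \<Longrightarrow> continuous_on UNIV (D i)) \<Longrightarrow> continuous_on UNIV (grad_form I D)"
  unfolding grad_form_def[abs_def] using lam_gt_1 by (intro continuous_intros) auto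

text \<open>\<open>I\<close> holds the coordinates that remain after conditioning, and
  \<open>poincare\<close> is the induction hypothesis for them.\<close>

context
  fixes I :: "nat set" and M :: real
  assumes I: "finite I"
    and poincare: "\<And>u D. C1_on I u D \<Longrightarrow> variance I M u \<le> mean I M (grad_form I D)"
begin

text \<open>Apply the hypothesis to the sum itself, whose gradient is constantly \<open>1\<close>:
  with \<open>m = card I\<close> the form equals \<open>m / (lam - 1 + m)\<close>. The bound keeps
  \<open>lam - Var S\<close> positive, and also \<open>2 - Var S\<close>, the convexity of the
  marginal potential.\<close>

lemma variance_sum_less_1: "variance I M (\<lambda>x. \<Sum>j\<in>I. x j) < 1"
proof -
  have "variance I M (\<lambda>x. \<Sum>j\<in>I. x j) \<le> mean I M (grad_form I (\<lambda>_ _. 1))"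
    by (intro poincare C1_on_sum I)
  also have "grad_form I (\<lambda>_ _. 1) = (\<lambda>_. real (card I) / (lam - 1 + real (card I)))"
  proof
    have "(n - n\<^sup>2 / (a + n)) / a = n / (a + n)" if "a > 0" "n \<ge> 0" for a n :: real
    proof -
      have "n - n\<^sup>2 / (a + n) = a * (n / (a + n))"
        using that by (simp add: field_simps power2_eq_square)
      then show ?thesis using that by simp
    qed
    then show "grad_form I (\<lambda>_ _. 1) x = real (card I) / (lam - 1 + real (card I))" for x
      using lam_gt_1 unfolding grad_form_def by simp
  qed
  also have "mean I M \<dots> < 1"
    using lam_gt_1 by (simp add: mean_const[OF I])
  finally show ?thesis .
qed

text \<open>For \<open>s = Y / (lam - Var S)\<close>, where \<open>Y\<^sup>2\<close> is the numerator below, the left-hand side equals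
  \<open>Var (u - s S) + 2 s Y + 2 s Cov (u, S) - s\<^sup>2 lam\<close>.\<close>
lemma variance_plus_square_le:
  assumes u: "C1_on I u D" and w: "continuous_on UNIV w"
  defines "S \<equiv> \<lambda>x. \<Sum>j\<in>I. x j"
  shows "variance I M u + (mean I M w - covariance I M u S)\<^sup>2 / (lam - variance I M S)
    \<le> mean I M (\<lambda>x. ((\<Sum>i\<in>I. (D i x)\<^sup>2) + (w x)\<^sup>2
        - ((\<Sum>i\<in>I. D i x) + w x)\<^sup>2 / (lam - 1 + (1 + real (card I)))) / (lam - 1))"
    (is "_ \<le> mean I M ?G")
proof -
  have kap: "lam - variance I M S > 0"
    using variance_sum_less_1 lam_gt_1 by (simp add: S_def)
  define Y where "Y = mean I M w - covariance I M u S"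
  define s where "s = Y / (lam - variance I M S)"
  have D: "continuous_on UNIV (D i)" if "i \<in> I" for i
    using u that by (simp add: C1_on_def)
  have cu: "continuous_on UNIV u" using u by (simp add: C1_on_def)
  have cS: "continuous_on UNIV S" unfolding S_def by (rule sum_coord_continuous)
  have "C1_on I (\<lambda>x. u x - s * S x) (\<lambda>i x. D i x - s * 1)"
    unfolding S_def by (intro C1_on_diff_cmult u C1_on_sum I)
  then have "variance I M (\<lambda>x. u x - s * S x) \<le> mean I M (grad_form I (\<lambda>i x. D i x - s))"
    using poincare by simp
  then have 1: "variance I M u - 2 * s * covariance I M u S + s\<^sup>2 * variance I M S
      \<le> mean I M (grad_form I (\<lambda>i x. D i x - s))"
    by (simp add: variance_diff_cmult[OF I cu cS])
  have cG: "continuous_on UNIV (grad_form I (\<lambda>i x. D i x - s))"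
    by (intro grad_form_continuous continuous_intros D)
  have "mean I M (grad_form I (\<lambda>i x. D i x - s)) + (2 * s * mean I M w - s\<^sup>2 * lam)
      = mean I M (\<lambda>x. grad_form I (\<lambda>i x. D i x - s) x + (2 * s * w x - s\<^sup>2 * lam))"
    by (simp only: mean_add[OF I] mean_diff[OF I] mean_cmult mean_const[OF I] cG w continuous_intros)
  also have "\<dots> \<le> mean I M ?G"
  proof (rule mean_mono[OF I])
    show "continuous_on UNIV ?G"
      using lam_gt_1 by (intro continuous_intros D w) auto
    fix x
    have "(\<Sum>i\<in>I. (D i x - s)\<^sup>2) = (\<Sum>i\<in>I. (D i x)\<^sup>2) - 2 * s * (\<Sum>i\<in>I. D i x) + s\<^sup>2 * card I"
      by (simp add: power2_diff sum.distrib sum_subtractf sum_distrib_left sum_distrib_right algebra_simps)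
    moreover have "(\<Sum>i\<in>I. D i x - s) = (\<Sum>i\<in>I. D i x) - s * card I"
      by (simp add: sum_subtractf)
    ultimately show "grad_form I (\<lambda>i x. D i x - s) x + (2 * s * w x - s\<^sup>2 * lam) \<le> ?G x"
      unfolding grad_form_def
      using schur_complement_le[of "lam - 1" "real (card I)" "\<Sum>i\<in>I. (D i x)\<^sup>2" s "\<Sum>i\<in>I. D i x" "w x"] lam_gt_1
      by simp
  qed (intro continuous_intros cG w)
  finally have 2: "mean I M (grad_form I (\<lambda>i x. D i x - s)) + (2 * s * mean I M w - s\<^sup>2 * lam) \<le> mean I M ?G" .
  have "Y\<^sup>2 / (lam - variance I M S) = 2 * s * Y - s\<^sup>2 * (lam - variance I M S)"
    using kap by (simp add: s_def power2_eq_square)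
  with 1 2 show ?thesis
    unfolding Y_def[symmetric] by (simp add: Y_def algebra_simps)
qed

end


section \<open>The marginal of one coordinate and the induction on the number of coordinates\<close>

lemma site_integral:
  assumes "continuous_on UNIV \<phi>"
  shows "(\<integral>t. site t * \<phi> t \<partial>lborel) = integral {-r..r} (\<lambda>t. exp (- V F t) * \<phi> t)"
proof -
  have "continuous_on {-r..r} (\<lambda>t. exp (- V F t) * \<phi> t)"
    by (intro continuous_intros exp_neg_V_continuous continuous_on_subset[OF assms]) auto
  from set_borel_integral_eq_integral(2)[OF borel_integrable_atLeastAtMost'[OF this]]
  show ?thesis by (simp add: set_lebesgue_integral_def site_def mult.assoc)
qed

text \<open>Holley-Stroock perturbation: the variance is at most the second moment about the center
  \<open>c\<close> found for \<open>p\<close> alone, and removing and reinserting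
  \<open>exp (- F)\<close> costs a factor \<open>exp eps\<close> each time.\<close>

lemma marginal_brascamp_lieb:
  fixes A g p h k :: "real \<Rightarrow> real"
  assumes A: "\<And>x. (A has_real_derivative k x) (at x)"
    and g: "\<And>x. (g has_real_derivative h x) (at x)"
    and p: "\<And>x. (p has_real_derivative - (A x * p x)) (at x)"
    and k: "\<And>x. k x > 0" and p0: "\<And>x. p x > 0"
    and ch: "continuous_on UNIV h" and ck: "continuous_on UNIV k"
  defines "J \<equiv> \<lambda>\<phi>. integral {-r..r} (\<lambda>t. exp (- F t) * p t * \<phi> t)"
  shows "J (\<lambda>t. (g t)\<^sup>2) / J (\<lambda>_. 1) - (J g / J (\<lambda>_. 1))\<^sup>2
    \<le> exp (2 * eps) * J (\<lambda>t. (h t)\<^sup>2 / k t) / J (\<lambda>_. 1)"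
proof -
  have cg: "continuous_on S g" and cp: "continuous_on S p" for S
    using g p by (meson DERIV_isCont continuous_at_imp_continuous_on)+
  have ch': "continuous_on S h" and ck': "continuous_on S k" and cF: "continuous_on S F" for S
    using ch ck F_cont continuous_on_subset by blast+
  have k0: "k x \<noteq> 0" for x
    using k[of x] by simp
  have int: "(\<lambda>t. exp (- F t) * p t * \<phi> t) integrable_on {-r..r}" if "continuous_on {-r..r} \<phi>" for \<phi>
    by (intro integrable_continuous_real continuous_intros cF cp that)
  obtain c where c: "integral {-r..r} (\<lambda>x. (g x - c)\<^sup>2 * p x) \<le> integral {-r..r} (\<lambda>x. (h x)\<^sup>2 / k x * p x)"
    using brascamp_lieb_interval[OF _ A g p k p0 ch ck, of "-r" r] r_pos by auto
  have J1: "J (\<lambda>_. 1) > 0"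
  proof -
    let ?f = "\<lambda>t. exp (- F t) * p t * 1"
    have cf: "continuous_on (cbox (-r) r) ?f"
      by (intro continuous_intros cF cp)
    have "J (\<lambda>_. 1) \<ge> 0"
      unfolding J_def by (intro integral_nonneg int continuous_intros) (simp add: less_imp_le p0)
    moreover have "J (\<lambda>_. 1) \<noteq> 0"
    proof
      assume "J (\<lambda>_. 1) = 0"
      then have "(?f has_integral 0) (cbox (-r) r)"
        using int[of "\<lambda>_. 1"] by (simp add: has_integral_iff J_def)
      from has_integral_0_cbox_imp_0[OF cf _ this, of 0] show False
        using r_pos p0 by (auto simp: less_imp_le less_imp_neq[THEN not_sym])
    qed
    ultimately show ?thesis by linarith
  qed
  have J_expand: "J (\<lambda>t. (g t - c)\<^sup>2) = J (\<lambda>t. (g t)\<^sup>2) - 2 * c * J g + c\<^sup>2 * J (\<lambda>_. 1)"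
  proof -
    have "J (\<lambda>t. (g t - c)\<^sup>2) = integral {-r..r} (\<lambda>t. exp (- F t) * p t * (g t)\<^sup>2
        - 2 * c * (exp (- F t) * p t * g t) + c\<^sup>2 * (exp (- F t) * p t * 1))"
      unfolding J_def by (intro integral_cong) (simp add: power2_eq_square algebra_simps)
    also have "\<dots> = J (\<lambda>t. (g t)\<^sup>2) - 2 * c * J g + c\<^sup>2 * J (\<lambda>_. 1)"
      unfolding J_def
      by (subst integral_add, (intro integrable_continuous_real continuous_intros cF cp cg)+,
          subst integral_diff, (intro integrable_continuous_real continuous_intros cF cp cg)+)
        (simp only: integral_mult_right)
    finally show ?thesis .
  qed
  have "J (\<lambda>t. (g t)\<^sup>2) / J (\<lambda>_. 1) - (J g / J (\<lambda>_. 1))\<^sup>2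
      \<le> J (\<lambda>t. (g t)\<^sup>2) / J (\<lambda>_. 1) - (J g / J (\<lambda>_. 1))\<^sup>2 + (J g / J (\<lambda>_. 1) - c)\<^sup>2"
    by simp
  also have "\<dots> = J (\<lambda>t. (g t - c)\<^sup>2) / J (\<lambda>_. 1)"
    unfolding J_expand using J1 by (simp add: field_simps power2_eq_square)
  also have "\<dots> \<le> exp (2 * eps) * J (\<lambda>t. (h t)\<^sup>2 / k t) / J (\<lambda>_. 1)"
  proof (rule divide_right_mono)
    have "J (\<lambda>t. (g t - c)\<^sup>2) \<le> integral {-r..r} (\<lambda>t. exp eps * ((g t - c)\<^sup>2 * p t))"
      unfolding J_def
    proof (rule integral_le)
      fix t
      have "exp (- F t) \<le> exp eps" using F_bound[of t] by auto
      then show "exp (- F t) * p t * (g t - c)\<^sup>2 \<le> exp eps * ((g t - c)\<^sup>2 * p t)"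
        using p0[of t] mult_right_mono[of "exp (- F t)" "exp eps" "(g t - c)\<^sup>2 * p t"]
        by (simp add: algebra_simps less_imp_le)
    qed (intro int integrable_continuous_real continuous_intros cg cp)+
    also have "\<dots> = exp eps * integral {-r..r} (\<lambda>t. (g t - c)\<^sup>2 * p t)"
      by simp
    also have "\<dots> \<le> exp eps * integral {-r..r} (\<lambda>t. (h t)\<^sup>2 / k t * p t)"
      using c by simp
    also have "integral {-r..r} (\<lambda>t. (h t)\<^sup>2 / k t * p t)
        \<le> integral {-r..r} (\<lambda>t. exp eps * (exp (- F t) * p t * ((h t)\<^sup>2 / k t)))"
    proof (rule integral_le)
      fix t
      have "1 \<le> exp eps * exp (- F t)" using F_bound[of t] by (simp add: mult_exp_exp abs_le_iff)
      then show "(h t)\<^sup>2 / k t * p t \<le> exp eps * (exp (- F t) * p t * ((h t)\<^sup>2 / k t))"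
        using p0[of t] k[of t] mult_right_mono[of 1 "exp eps * exp (- F t)" "(h t)\<^sup>2 / k t * p t"]
        by (simp add: algebra_simps less_imp_le)
    qed (intro integrable_continuous_real continuous_intros ch' ck' cp cF; simp add: k0)+
    also have "\<dots> = exp eps * J (\<lambda>t. (h t)\<^sup>2 / k t)"
      unfolding J_def by (rule integral_mult_right)
    finally show "J (\<lambda>t. (g t - c)\<^sup>2) \<le> exp (2 * eps) * J (\<lambda>t. (h t)\<^sup>2 / k t)"
      by (simp add: mult.assoc[symmetric] exp_add[symmetric])
  qed (use J1 in simp)
  finally show ?thesis .
qed

lemma grad_form_insert:
  assumes "finite I" "i \<notin> I"
  shows "grad_form (insert i I) D x =
    ((\<Sum>j\<in>I. (D j x)\<^sup>2) + (D i x)\<^sup>2 - ((\<Sum>j\<in>I. D j x) + D i x)\<^sup>2 / (lam - 1 + (1 + real (card I)))) / (lam - 1)"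
  using assms by (simp add: grad_form_def add.commute)

lemma poincare_insert:
  assumes I: "finite I" "i \<notin> I"
    and IH: "\<And>M u D. C1_on I u D \<Longrightarrow> variance I M u \<le> mean I M (grad_form I D)"
    and u: "C1_on (insert i I) u D"
  shows "variance (insert i I) M u \<le> mean (insert i I) M (grad_form (insert i I) D)"
proof -
  let ?S = "\<lambda>x :: nat \<Rightarrow> real. \<Sum>j\<in>I. x j"
  let ?G = "grad_form (insert i I) D"
  have cu: "continuous_on UNIV u" and cDi: "continuous_on UNIV (D i)"
    and di: "\<And>x. ((\<lambda>t. u (x(i := t))) has_real_derivative D i x) (at (x i))"
    and cD: "\<And>j. j \<in> insert i I \<Longrightarrow> continuous_on UNIV (D j)"
    using u by (auto simp: C1_on_def)
  have cG: "continuous_on UNIV ?G"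
    using cD by (rule grad_form_continuous)
  have cS: "continuous_on UNIV ?S" by (rule sum_coord_continuous)
  have S_upd: "(\<Sum>j\<in>I. (x(i := t)) j) = ?S x" for x :: "nat \<Rightarrow> real" and t
    using I by (intro sum.cong) auto
  \<comment> \<open>\<open>exp (- F t) * p t\<close> is the unnormalized marginal density of
    coordinate \<open>i\<close>. Differentiation will give \<open>p' = - A p\<close>,
    \<open>A' = 2 - v\<close> and \<open>g' = h\<close>, with \<open>v\<close> the conditional
    variance of the sum.\<close>
  define p where "p t = exp (- t\<^sup>2 / 2) * gint I (M - t) (\<lambda>_. 1)" for t
  define A where "A t = 2 * t - M + mean I (M - t) ?S" for t
  define v where "v t = variance I (M - t) ?S" for t
  define g where "g t = mean I (M - t) (\<lambda>x. u (x(i := t)))" for t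
  define h where "h t = mean I (M - t) (\<lambda>x. D i (x(i := t))) - covariance I (M - t) (\<lambda>x. u (x(i := t))) ?S" for t
  define J where "J \<phi> = integral {-r..r} (\<lambda>t. exp (- F t) * p t * \<phi> t)" for \<phi>
  have mean_S: "continuous_on UNIV (\<lambda>t. mean I (M - t) ?S)"
    using mean_slice_continuous[OF I cS, of M] unfolding S_upd .
  have mean_S2: "continuous_on UNIV (\<lambda>t. mean I (M - t) (\<lambda>x. (?S x)\<^sup>2))"
    using mean_slice_continuous[OF I continuous_on_power[OF cS, of 2], of M] unfolding S_upd .
  have mean_uS: "continuous_on UNIV (\<lambda>t. mean I (M - t) (\<lambda>x. u (x(i := t)) * ?S x))"
    using mean_slice_continuous[OF I continuous_on_mult[OF cu cS], of M] unfolding S_upd .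
  have gint_1: "continuous_on UNIV (\<lambda>t. gint I (M - t) (\<lambda>_. 1))"
    using gint_slice_continuous[OF I, of "\<lambda>_. 1" M] by simp
  have cg: "continuous_on UNIV g" unfolding g_def by (rule mean_slice_continuous[OF I cu])
  have cv: "continuous_on UNIV v"
    unfolding v_def variance_def by (intro continuous_intros mean_S mean_S2)
  have ch: "continuous_on UNIV h"
    unfolding h_def covariance_def
    by (intro continuous_intros mean_S mean_uS mean_slice_continuous[OF I] cu cDi)
  have cp: "continuous_on UNIV p"
    unfolding p_def by (intro continuous_intros gint_1) auto
  have v_less: "v t < 1" for t
    unfolding v_def by (rule variance_sum_less_1[OF I(1) IH])
  have v_ge: "v t \<ge> 0" for t
    unfolding v_def by (rule variance_nonneg[OF I(1) cS])
  have p_pos: "p t > 0" for t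
    using gint_pos[OF I(1)] by (simp add: p_def)
  \<comment> \<open>Tower property: \<open>J\<close> integrates against the marginal, so applied to
    conditional means it returns the integral over all coordinates.\<close>
  have J_eq: "J (\<lambda>t. mean I (M - t) (\<lambda>x. w (x(i := t)))) = gint (insert i I) M w"
    if w: "continuous_on UNIV w" for w
  proof -
    have "gint (insert i I) M w = integral {-r..r} (\<lambda>t. exp (- V F t) * gint I (M - t) (\<lambda>x. w (x(i := t))))"
      unfolding gint_insert[OF I w] by (rule site_integral[OF gint_slice_continuous[OF I w]])
    also have "\<dots> = J (\<lambda>t. mean I (M - t) (\<lambda>x. w (x(i := t))))"
    proof -
      have "exp (- V F t) = exp (- F t) * exp (- t\<^sup>2 / 2)" for t
        by (simp add: V_def mult_exp_exp)
      then show ?thesis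
        using gint_pos[OF I(1)] unfolding J_def p_def mean_def
        by (intro integral_cong) (simp add: less_imp_neq[THEN not_sym])
    qed
    finally show ?thesis by simp
  qed
  have J_one: "J (\<lambda>_. 1) = gint (insert i I) M (\<lambda>_. 1)"
    using J_eq[of "\<lambda>_. 1"] by (simp add: mean_const[OF I(1)])
  have J_mean: "J (\<lambda>t. mean I (M - t) (\<lambda>x. w (x(i := t)))) / J (\<lambda>_. 1) = mean (insert i I) M w"
    if w: "continuous_on UNIV w" for w
    unfolding J_eq[OF w] J_one mean_def[of "insert i I"] ..
  have J1: "J (\<lambda>_. 1) > 0"
    unfolding J_one using I by (intro gint_pos) simp
  have J_int: "(\<lambda>t. exp (- F t) * p t * \<phi> t) integrable_on {-r..r}" if "continuous_on UNIV \<phi>" for \<phi>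
    by (intro integrable_continuous_real continuous_intros continuous_on_subset[OF F_cont]
        continuous_on_subset[OF cp] continuous_on_subset[OF that]) auto
  have J_add: "J (\<lambda>t. \<phi> t + \<psi> t) = J \<phi> + J \<psi>" if "continuous_on UNIV \<phi>" "continuous_on UNIV \<psi>" for \<phi> \<psi>
    unfolding J_def using integral_add[OF J_int[OF that(1)] J_int[OF that(2)]] by (simp add: distrib_left)
  have J_cmult: "J (\<lambda>t. c * \<phi> t) = c * J \<phi>" for c \<phi>
    unfolding J_def integral_mult_right[symmetric] by (intro integral_cong) simp
  have J_mono: "J \<phi> \<le> J \<psi>" if "continuous_on UNIV \<phi>" "continuous_on UNIV \<psi>" "\<And>t. \<phi> t \<le> \<psi> t" for \<phi> \<psi>
    unfolding J_def by (intro integral_le J_int that mult_left_mono) (simp add: less_imp_le p_pos)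
  have marginal: "J (\<lambda>t. (g t)\<^sup>2) / J (\<lambda>_. 1) - (J g / J (\<lambda>_. 1))\<^sup>2
    \<le> exp (2 * eps) * J (\<lambda>t. (h t)\<^sup>2 / (2 - v t)) / J (\<lambda>_. 1)"
    unfolding J_def
  proof (rule marginal_brascamp_lieb)
    show "(A has_real_derivative 2 - v t) (at t)" for t
    proof -
      \<comment> \<open>The sum over \<open>I\<close> does not depend on \<open>x i\<close>, so only
        the covariance term of \<open>mean_slice_deriv\<close> remains, here the covariance of the
        sum with itself.\<close>
      have "((\<lambda>t. mean I (M - t) ?S) has_real_derivative - v t) (at t)"
        using mean_slice_deriv[OF I cS, of "\<lambda>_. 0" M t] unfolding S_upd
        by (simp add: mean_const[OF I(1)] v_def variance_def covariance_def power2_eq_square)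
      then show ?thesis
        unfolding A_def by (auto intro!: derivative_eq_intros)
    qed
    show "(g has_real_derivative h t) (at t)" for t
      unfolding g_def h_def by (rule mean_slice_deriv[OF I cu cDi di])
    show "(p has_real_derivative - (A t * p t)) (at t)" for t
    proof -
      have "((\<lambda>t. exp (- t\<^sup>2 / 2)) has_real_derivative - t * exp (- t\<^sup>2 / 2)) (at t)"
        by (auto intro!: derivative_eq_intros)
      from DERIV_mult[OF this gint_one_deriv[OF I, of M t]] show ?thesis
        unfolding p_def A_def by (simp add: algebra_simps)
    qed
    show "2 - v t > 0" for t using v_less[of t] by simp
  qed (auto intro!: p_pos ch cv continuous_intros)
  have lam_v: "lam - v t > 0" for t
    using lam_gt_1 v_less[of t] by simp
  \<comment> \<open>From \<open>v t \<ge> 0\<close> and \<open>exp (- 2 * eps) \<le> 1\<close>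
    follows \<open>lam - v t \<le> exp (- 2 * eps) * (2 - v t)\<close>: the cost of the perturbation
    is absorbed in passing from \<open>2\<close> to \<open>lam\<close>.\<close>
  have factor: "exp (2 * eps) * ((h t)\<^sup>2 / (2 - v t)) \<le> (h t)\<^sup>2 / (lam - v t)" for t
  proof -
    have "eps \<ge> 0" using F_bound[of 0] by simp
    then have "exp (- 2 * eps) * v t \<le> v t"
      using v_ge[of t] by (intro mult_left_le_one_le) auto
    then have "lam - v t \<le> exp (- 2 * eps) * (2 - v t)"
      by (simp add: algebra_simps)
    also have "\<dots> = (2 - v t) / exp (2 * eps)"
      by (simp add: exp_minus divide_inverse mult.commute)
    finally have "(h t)\<^sup>2 / ((2 - v t) / exp (2 * eps)) \<le> (h t)\<^sup>2 / (lam - v t)"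
      using lam_v[of t] by (intro divide_left_mono mult_pos_pos) (auto intro: less_le_trans)
    then show ?thesis by (simp add: mult.commute)
  qed
  let ?v = "\<lambda>t. variance I (M - t) (\<lambda>x. u (x(i := t)))"
  have u2: "continuous_on UNIV (\<lambda>x. (u x)\<^sup>2)"
    by (intro continuous_intros cu)
  have v_eq: "?v t = mean I (M - t) (\<lambda>x. (u (x(i := t)))\<^sup>2) - (g t)\<^sup>2" for t
    by (simp add: variance_def g_def)
  have cvar: "continuous_on UNIV ?v"
    unfolding v_eq by (intro continuous_intros cg mean_slice_continuous[OF I u2])
  have nz: "v t \<noteq> 2" for t
    using v_less[of t] by auto
  have "g = (\<lambda>t. mean I (M - t) (\<lambda>x. u (x(i := t))))"
    by (rule ext) (rule g_def)
  then have J_g: "J g / J (\<lambda>_. 1) = mean (insert i I) M u"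
    using J_mean[OF cu] by simp
  have J_v: "J (\<lambda>t. ?v t + (g t)\<^sup>2) / J (\<lambda>_. 1) = mean (insert i I) M (\<lambda>x. (u x)\<^sup>2)"
    using J_mean[OF u2] by (simp add: v_eq)
  \<comment> \<open>Law of total variance; the variance of the conditional mean \<open>g\<close> is
    then bounded by \<open>marginal\<close>.\<close>
  have "variance (insert i I) M u = J (\<lambda>t. ?v t + (g t)\<^sup>2) / J (\<lambda>_. 1) - (J g / J (\<lambda>_. 1))\<^sup>2"
    unfolding variance_def[of "insert i I"] J_g J_v ..
  also have "\<dots> = J ?v / J (\<lambda>_. 1) + (J (\<lambda>t. (g t)\<^sup>2) / J (\<lambda>_. 1) - (J g / J (\<lambda>_. 1))\<^sup>2)"
    by (subst J_add) (auto intro!: cvar cg continuous_intros simp: add_divide_distrib)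
  also have "\<dots> \<le> J ?v / J (\<lambda>_. 1) + exp (2 * eps) * J (\<lambda>t. (h t)\<^sup>2 / (2 - v t)) / J (\<lambda>_. 1)"
    using marginal by simp
  also have "\<dots> = (J ?v + J (\<lambda>t. exp (2 * eps) * ((h t)\<^sup>2 / (2 - v t)))) / J (\<lambda>_. 1)"
    by (simp only: J_cmult add_divide_distrib)
  also have "\<dots> = J (\<lambda>t. ?v t + exp (2 * eps) * ((h t)\<^sup>2 / (2 - v t))) / J (\<lambda>_. 1)"
    by (subst J_add) (auto intro!: cvar ch cv continuous_intros simp: nz)
  also have "\<dots> \<le> J (\<lambda>t. mean I (M - t) (\<lambda>x. ?G (x(i := t)))) / J (\<lambda>_. 1)"
  proof (intro divide_right_mono J_mono)
    fix t
    have "?v t + (h t)\<^sup>2 / (lam - v t) \<le> mean I (M - t) (\<lambda>x. ?G (x(i := t)))"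
      unfolding h_def v_def grad_form_insert[OF I]
      by (rule variance_plus_square_le[OF I(1) IH C1_on_slice[OF u I(2)] continuous_on_fun_upd[OF cDi]])
    then show "?v t + exp (2 * eps) * ((h t)\<^sup>2 / (2 - v t)) \<le> mean I (M - t) (\<lambda>x. ?G (x(i := t)))"
      using factor[of t] by simp
  qed (use J1 in \<open>auto intro!: cvar ch cv continuous_intros mean_slice_continuous[OF I cG] simp: nz\<close>)
  also have "\<dots> = mean (insert i I) M ?G"
    by (rule J_mean[OF cG])
  finally show ?thesis .
qed

lemma box_poincare:
  assumes "finite I" "C1_on I u D"
  shows "variance I M u \<le> mean I M (grad_form I D)"
  using assms
proof (induction I arbitrary: M u D rule: finite_induct)
  case empty
  \<comment> \<open>Over no coordinates the measure is the point mass at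
    \<open>\<lambda>_. undefined\<close>, and both sides are \<open>0\<close>.\<close>
  have int: "integral\<^sup>L (Pi\<^sub>M {} (\<lambda>_::nat. lborel :: real measure)) w = w (\<lambda>_. undefined)" for w :: "(nat \<Rightarrow> real) \<Rightarrow> real"
    by (simp add: PiM_empty lebesgue_integral_count_space_finite)
  have "mean {} M w = w (\<lambda>_. undefined)" for w
    unfolding mean_def gint_def box_int_def int by (simp add: gauss_def)
  then show ?case by (simp add: variance_def grad_form_def)
next
  case (insert i I)
  show ?case
    by (rule poincare_insert[OF insert.hyps insert.IH insert.prems])
qed

text \<open>The subtracted square in \<open>grad_form\<close>, with the denominator that depends on
  \<open>card I\<close>, is nonnegative and may be dropped.\<close>

lemma box_poincare_grad:
  assumes I: "finite I" and u: "C1_on I u D"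
  shows "variance I M u \<le> mean I M (\<lambda>x. \<Sum>i\<in>I. (D i x)\<^sup>2) / (lam - 1)"
proof -
  have cD: "\<And>j. j \<in> I \<Longrightarrow> continuous_on UNIV (D j)"
    using u by (auto simp: C1_on_def)
  have "mean I M (grad_form I D) \<le> mean I M (\<lambda>x. 1 / (lam - 1) * (\<Sum>i\<in>I. (D i x)\<^sup>2))"
  proof (rule mean_mono[OF I grad_form_continuous[OF cD]])
    show "continuous_on UNIV (\<lambda>x. 1 / (lam - 1) * (\<Sum>i\<in>I. (D i x)\<^sup>2))"
      by (intro continuous_intros cD)
    fix x
    have "0 \<le> (\<Sum>i\<in>I. D i x)\<^sup>2 / (lam - 1 + real (card I))"
      using lam_gt_1 by simp
    then show "grad_form I D x \<le> 1 / (lam - 1) * (\<Sum>i\<in>I. (D i x)\<^sup>2)"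
      using lam_gt_1 unfolding grad_form_def by (simp add: divide_right_mono)
  qed
  then show ?thesis
    using box_poincare[OF I u, of M] unfolding mean_cmult by simp
qed

end

section \<open>The limit of large boxes\<close>

context site_density
begin

lemma gint_square_diff_mean:
  assumes I: "finite I" and u: "continuous_on UNIV u"
  shows "gint I M (\<lambda>x. (u x - mean I M u)\<^sup>2) = gint I M (\<lambda>_. 1) * variance I M u"
proof -
  let ?c = "mean I M u"
  have "variance I M (\<lambda>x. u x - ?c * 1) = variance I M u"
    using I u by (subst variance_diff_cmult) (simp_all add: covariance_def variance_def mean_const)
  moreover have "variance I M (\<lambda>x. u x - ?c * 1) = mean I M (\<lambda>x. (u x - ?c)\<^sup>2)"
    using I u by (simp add: variance_def mean_diff mean_const)
  ultimately show ?thesis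
    using gint_pos[OF I, of M] by (simp add: mean_def)
qed

text \<open>Clearing the normalization and leaving the center free gives a form in which the
  nonnegative weights grow with the box, ready for the limit.\<close>

lemma box_poincare_unnormalized:
  assumes I: "finite I" and u: "C1_on I u D"
  shows "\<exists>c. gint I M (\<lambda>x. (u x - c)\<^sup>2) \<le> gint I M (\<lambda>x. \<Sum>i\<in>I. (D i x)\<^sup>2) / (lam - 1)"
proof
  have "gint I M (\<lambda>x. (u x - mean I M u)\<^sup>2) = gint I M (\<lambda>_. 1) * variance I M u"
    using u by (intro gint_square_diff_mean I) (simp add: C1_on_def)
  also have "\<dots> \<le> gint I M (\<lambda>_. 1) * (mean I M (\<lambda>x. \<Sum>i\<in>I. (D i x)\<^sup>2) / (lam - 1))"
    using gint_pos[OF I, of M] box_poincare_grad[OF I u] by (intro mult_left_mono) auto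
  also have "\<dots> = gint I M (\<lambda>x. \<Sum>i\<in>I. (D i x)\<^sup>2) / (lam - 1)"
    using gint_pos[OF I, of M] by (simp add: mean_def)
  finally show "gint I M (\<lambda>x. (u x - mean I M u)\<^sup>2) \<le> gint I M (\<lambda>x. \<Sum>i\<in>I. (D i x)\<^sup>2) / (lam - 1)" .
qed

lemma gint_integrable:
  "finite I \<Longrightarrow> continuous_on UNIV u \<Longrightarrow>
    integrable (Pi\<^sub>M I (\<lambda>_. lborel)) (\<lambda>x. u x * gauss I M x * (\<Prod>i\<in>I. site (x i)))"
  by (intro box_integrable continuous_intros gauss_continuous)

end

text \<open>The pointwise limit, as \<open>r\<close> tends to infinity, of the weights under
  \<open>gint\<close>; \<open>weight\<close> has the further factor
  \<open>exp (- F (M - S))\<close>.\<close>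

definition full_weight :: "(real \<Rightarrow> real) \<Rightarrow> nat set \<Rightarrow> real \<Rightarrow> (nat \<Rightarrow> real) \<Rightarrow> real" where
  "full_weight F I M x = gauss I M x * (\<Prod>i\<in>I. exp (- V F (x i)))"

lemma full_weight_eq:
  "finite I \<Longrightarrow> full_weight F I M x = exp (- (\<Sum>i\<in>I. V F (x i)) - (M - (\<Sum>i\<in>I. x i))\<^sup>2 / 2)"
  by (simp add: full_weight_def gauss_def exp_sum[symmetric] sum_negf mult_exp_exp)

lemma full_weight_nonneg: "full_weight F I M x \<ge> 0"
  by (simp add: full_weight_def gauss_def prod_nonneg)

lemma full_weight_measurable:
  assumes "continuous_on UNIV F"
  shows "full_weight F I M \<in> borel_measurable (Pi\<^sub>M I (\<lambda>_. lborel))"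
proof -
  have [measurable]: "F \<in> borel_measurable borel"
    using assms by (rule borel_measurable_continuous_onI)
  show ?thesis
    unfolding full_weight_def[abs_def] gauss_def[abs_def] V_def[abs_def] by measurable
qed

text \<open>The minimizing constants for the boxes stay bounded; along a convergent subsequence Fatou's
  lemma applies.\<close>
lemma full_poincare:
  fixes F :: "real \<Rightarrow> real"
  assumes F: "continuous_on UNIV F" "\<And>u. \<bar>F u\<bar> \<le> eps" and small: "exp (2 * eps) < 2"
    and I: "finite I" and u: "C1_on I u D"
    and int: "integrable (Pi\<^sub>M I (\<lambda>_. lborel)) (\<lambda>x. (\<Sum>i\<in>I. (D i x)\<^sup>2) * full_weight F I M x)"
  shows "\<exists>c. (\<integral>\<^sup>+x. ennreal ((u x - c)\<^sup>2 * full_weight F I M x) \<partial>Pi\<^sub>M I (\<lambda>_. lborel))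
    \<le> ennreal ((\<integral>x. (\<Sum>i\<in>I. (D i x)\<^sup>2) * full_weight F I M x \<partial>Pi\<^sub>M I (\<lambda>_. lborel)) / (2 * exp (- 2 * eps) - 1))"
proof -
  note of_nat_Suc [simp del]
  let ?L = "Pi\<^sub>M I (\<lambda>_. lborel) :: (nat \<Rightarrow> real) measure"
  define K where "K = (\<integral>x. (\<Sum>i\<in>I. (D i x)\<^sup>2) * full_weight F I M x \<partial>?L) / (2 * exp (- 2 * eps) - 1)"
  define g where "g = gauss I M"
  \<comment> \<open>\<open>Suc n\<close> keeps the half side of the box positive also for
    \<open>n = 0\<close>.\<close>
  define w where "w n x = (\<Prod>i\<in>I. site_density.site F (real (Suc n)) (x i))" for n and x :: "nat \<Rightarrow> real"
  have sd: "site_density F (real (Suc n)) eps" for n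
    using F small by unfold_locales auto
  have cu: "continuous_on UNIV u" and cD: "\<And>i. i \<in> I \<Longrightarrow> continuous_on UNIV (D i)"
    using u by (auto simp: C1_on_def)
  have gint: "site_density.gint F (real (Suc n)) I M \<phi> = (\<integral>x. \<phi> x * g x * w n x \<partial>?L)" for n \<phi>
    by (simp add: site_density.gint_def[OF sd] site_density.box_int_def[OF sd] g_def w_def)
  have w_int: "integrable ?L (\<lambda>x. \<phi> x * g x * w n x)" if "continuous_on UNIV \<phi>" for \<phi> n
    unfolding g_def w_def by (rule site_density.gint_integrable[OF sd I that])
  have g_pos: "g x > 0" for x
    by (simp add: g_def gauss_def)
  have site: "site_density.site F (real (Suc n)) t = indicator {- real (Suc n)..real (Suc n)} t * exp (- V F t)" for n t
    by (rule site_density.site_def[OF sd])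
  have w_nonneg: "w n x \<ge> 0" for n x
    unfolding w_def by (intro prod_nonneg) (simp add: site)
  have w_mono: "w m x \<le> w n x" if "m \<le> n" for m n x
    unfolding w_def using that by (intro prod_mono) (auto simp: site split: split_indicator)
  have w_le: "g x * w n x \<le> full_weight F I M x" for n x
    unfolding w_def full_weight_def g_def[symmetric] using g_pos[of x]
    by (intro mult_left_mono prod_mono) (auto simp: site split: split_indicator)
  have w_lim: "(\<lambda>n. w (s n) x) \<longlonglongrightarrow> (\<Prod>i\<in>I. exp (- V F (x i)))" if "strict_mono s" for s x
    unfolding w_def
  proof (rule tendsto_prod)
    fix i assume "i \<in> I"
    obtain N where N: "\<bar>x i\<bar> \<le> real N" using real_arch_simple by blast
    show "(\<lambda>n. site_density.site F (real (Suc (s n))) (x i)) \<longlonglongrightarrow> exp (- V F (x i))"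
    proof (rule tendsto_eventually, rule eventually_sequentiallyI)
      fix n assume "n \<ge> N"
      then have "N \<le> s n" using seq_suble[OF that, of n] by linarith
      then have "real N \<le> real (s n)" by simp
      then have "\<bar>x i\<bar> \<le> real (Suc (s n))" using N by simp
      then show "site_density.site F (real (Suc (s n))) (x i) = exp (- V F (x i))"
        unfolding site by (auto simp: abs_le_iff)
    qed
  qed
  have lam: "2 * exp (- 2 * eps) - 1 > 0"
    using site_density.lam_gt_1[OF sd] by simp
  have "\<exists>c. (\<integral>x. (u x - c)\<^sup>2 * g x * w n x \<partial>?L) \<le> K" for n
  proof -
    obtain c where c: "(\<integral>x. (u x - c)\<^sup>2 * g x * w n x \<partial>?L)
        \<le> (\<integral>x. (\<Sum>i\<in>I. (D i x)\<^sup>2) * g x * w n x \<partial>?L) / (2 * exp (- 2 * eps) - 1)"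
      using site_density.box_poincare_unnormalized[OF sd I u, of n M] unfolding gint by auto
    have "(\<integral>x. (\<Sum>i\<in>I. (D i x)\<^sup>2) * g x * w n x \<partial>?L) \<le> (\<integral>x. (\<Sum>i\<in>I. (D i x)\<^sup>2) * full_weight F I M x \<partial>?L)"
    proof (intro integral_mono int w_int continuous_intros cD)
      show "(\<Sum>i\<in>I. (D i x)\<^sup>2) * g x * w n x \<le> (\<Sum>i\<in>I. (D i x)\<^sup>2) * full_weight F I M x" for x
        unfolding mult.assoc by (intro mult_left_mono w_le sum_nonneg) simp
    qed
    with c lam have "(\<integral>x. (u x - c)\<^sup>2 * g x * w n x \<partial>?L) \<le> K"
      unfolding K_def by (meson divide_right_mono less_imp_le order_trans)
    then show ?thesis ..
  qed
  then obtain c where c: "\<And>n. (\<integral>x. (u x - c n)\<^sup>2 * g x * w n x \<partial>?L) \<le> K"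
    by metis
  have "bounded (range c)"
  proof -
    let ?J = "\<lambda>\<phi>. \<integral>x. \<phi> x * g x * w 0 x \<partial>?L"
    have J1: "?J (\<lambda>_. 1) > 0"
      using site_density.gint_pos[OF sd I, of 0 M] unfolding gint .
    \<comment> \<open>On the smallest box use
      \<open>c\<^sup>2 \<le> 2 * (u - c)\<^sup>2 + 2 * u\<^sup>2\<close>. Since the weights increase
      with the box, \<open>K\<close> controls the integral of \<open>(u - c)\<^sup>2\<close> there
      too.\<close>
    have "(c n)\<^sup>2 \<le> (2 * K + 2 * ?J (\<lambda>x. (u x)\<^sup>2)) / ?J (\<lambda>_. 1)" for n
    proof -
      have "(c n)\<^sup>2 * ?J (\<lambda>_. 1) = (\<integral>x. (c n)\<^sup>2 * (1 * g x * w 0 x) \<partial>?L)"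
        by (rule integral_mult_right_zero[symmetric])
      also have "\<dots> \<le> (\<integral>x. 2 * ((u x - c n)\<^sup>2 * g x * w n x) + 2 * ((u x)\<^sup>2 * g x * w 0 x) \<partial>?L)"
      proof (intro integral_mono)
        fix x
        have "(c n)\<^sup>2 \<le> 2 * (u x - c n)\<^sup>2 + 2 * (u x)\<^sup>2"
          using zero_le_power2[of "2 * u x - c n"] by (simp add: power2_eq_square algebra_simps)
        then have "(c n)\<^sup>2 * (g x * w 0 x) \<le> (2 * (u x - c n)\<^sup>2 + 2 * (u x)\<^sup>2) * (g x * w 0 x)"
          using g_pos[of x] w_nonneg[of 0 x] by (intro mult_right_mono) auto
        moreover have "(u x - c n)\<^sup>2 * (g x * w 0 x) \<le> (u x - c n)\<^sup>2 * (g x * w n x)"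
          using g_pos[of x] w_mono[of 0 n x] by (intro mult_left_mono) auto
        ultimately show "(c n)\<^sup>2 * (1 * g x * w 0 x) \<le> 2 * ((u x - c n)\<^sup>2 * g x * w n x) + 2 * ((u x)\<^sup>2 * g x * w 0 x)"
          by (simp add: algebra_simps)
      qed (intro Bochner_Integration.integrable_add integrable_mult_right w_int continuous_intros cu)+
      also have "\<dots> = 2 * (\<integral>x. (u x - c n)\<^sup>2 * g x * w n x \<partial>?L) + 2 * ?J (\<lambda>x. (u x)\<^sup>2)"
        by (subst Bochner_Integration.integral_add)
          (auto intro!: integrable_mult_right w_int continuous_intros cu simp del: integrable_mult_right_iff)
      also have "\<dots> \<le> 2 * K + 2 * ?J (\<lambda>x. (u x)\<^sup>2)"
        using c[of n] by simp
      finally show ?thesis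
        using J1 by (simp add: pos_le_divide_eq)
    qed
    then have "\<bar>c n\<bar> \<le> sqrt ((2 * K + 2 * ?J (\<lambda>x. (u x)\<^sup>2)) / ?J (\<lambda>_. 1))" for n
      using real_le_rsqrt[of "\<bar>c n\<bar>"] by simp
    then show ?thesis by (auto simp: bounded_iff)
  qed
  then obtain l s where s: "strict_mono s" "(c \<circ> s) \<longlonglongrightarrow> l"
    using bounded_imp_convergent_subsequence by blast
  note borel_measurable_PiM_continuous[OF cu, measurable]
  have g_meas[measurable]: "g \<in> borel_measurable ?L"
    unfolding g_def by (intro borel_measurable_PiM_continuous gauss_continuous)
  have w_meas[measurable]: "w n \<in> borel_measurable ?L" for n
  proof -
    note site_density.site_measurable[OF sd, measurable]
    show ?thesis unfolding w_def[abs_def] by measurable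
  qed
  let ?f = "\<lambda>n x. ennreal ((u x - c (s n))\<^sup>2 * g x * w (s n) x)"
  have "(\<integral>\<^sup>+x. ennreal ((u x - l)\<^sup>2 * full_weight F I M x) \<partial>?L) = (\<integral>\<^sup>+x. liminf (\<lambda>n. ?f n x) \<partial>?L)"
  proof (rule nn_integral_cong)
    fix x
    have "(\<lambda>n. (u x - (c \<circ> s) n)\<^sup>2 * g x * w (s n) x) \<longlonglongrightarrow> (u x - l)\<^sup>2 * g x * (\<Prod>i\<in>I. exp (- V F (x i)))"
      by (intro tendsto_intros s w_lim)
    then have "(\<lambda>n. ?f n x) \<longlonglongrightarrow> ennreal ((u x - l)\<^sup>2 * full_weight F I M x)"
      by (intro tendsto_ennrealI) (simp add: full_weight_def g_def mult.assoc)
    then show "ennreal ((u x - l)\<^sup>2 * full_weight F I M x) = liminf (\<lambda>n. ?f n x)"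
      by (simp add: lim_imp_Liminf)
  qed
  also have "\<dots> \<le> liminf (\<lambda>n. integral\<^sup>N ?L (?f n))"
    by (rule nn_integral_liminf) measurable
  also have "\<dots> \<le> ennreal K"
  proof (rule Liminf_le)
    show "\<forall>\<^sub>F n in sequentially. integral\<^sup>N ?L (?f n) \<le> ennreal K"
    proof (intro always_eventually allI)
      fix n
      have "integral\<^sup>N ?L (?f n) = ennreal (\<integral>x. (u x - c (s n))\<^sup>2 * g x * w (s n) x \<partial>?L)"
        by (intro nn_integral_eq_integral w_int continuous_intros cu)
          (auto simp: less_imp_le g_pos w_nonneg)
      also have "\<dots> \<le> ennreal K"
        by (intro ennreal_leI c)
      finally show "integral\<^sup>N ?L (?f n) \<le> ennreal K" .
    qed
  qed simp
  finally show ?thesis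
    unfolding K_def by blast
qed


section \<open>Smooth functions on \<open>Rn n\<close> and the transfer to
  \<open>sigma_meas\<close>\<close>

lemma continuous_on_restrict_comp:
  fixes f :: "(nat \<Rightarrow> real) \<Rightarrow> real"
  assumes "continuous_on (Rn n) f"
  shows "continuous_on UNIV (\<lambda>x. f (restrict x {1..n}))"
proof (rule continuous_on_compose2[OF assms])
  show "continuous_on UNIV (\<lambda>x :: nat \<Rightarrow> real. restrict x {1..n})"
  proof (rule continuous_on_coordinatewise_then_product)
    show "continuous_on UNIV (\<lambda>x :: nat \<Rightarrow> real. restrict x {1..n} j)" for j
      by (cases "j \<in> {1..n}") auto
  qed
qed auto

text \<open>Precomposing with \<open>restrict\<close> extends \<open>f\<close> from
  \<open>Rn n\<close> to the whole function space and commutes with updating a coordinate in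
  \<open>{1..n}\<close>. The lists \<open>[]\<close> and \<open>[i]\<close> in
  \<open>smooth_Rn\<close> give the continuity of \<open>f\<close> and of its partial
  derivatives.\<close>

lemma smooth_Rn_C1_on:
  assumes "smooth_Rn n f"
  shows "C1_on {1..n} (\<lambda>x. f (restrict x {1..n})) (\<lambda>i x. partial i f (restrict x {1..n}))"
  unfolding C1_on_def
proof (intro conjI ballI allI)
  have f: "continuous_on (Rn n) f" "\<And>i x. i \<in> {1..n} \<Longrightarrow> x \<in> Rn n \<Longrightarrow>
      (\<lambda>t. f (x(i := t))) differentiable (at (x i))"
    using assms[unfolded smooth_Rn_def, rule_format, of "[]"] by auto
  show "continuous_on UNIV (\<lambda>x. f (restrict x {1..n}))"
    by (rule continuous_on_restrict_comp[OF f(1)])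
  fix i assume i: "i \<in> {1..n}"
  then have "continuous_on (Rn n) (partial i f)"
    using assms[unfolded smooth_Rn_def, rule_format, of "[i]"] by auto
  then show "continuous_on UNIV (\<lambda>x. partial i f (restrict x {1..n}))"
    by (rule continuous_on_restrict_comp)
  fix x :: "nat \<Rightarrow> real"
  let ?y = "restrict x {1..n}"
  have "restrict (x(i := t)) {1..n} = ?y(i := t)" for t
    using i by (auto simp: restrict_def fun_eq_iff)
  moreover have "((\<lambda>t. f (?y(i := t))) has_real_derivative partial i f ?y) (at (?y i))"
    unfolding partial_def using f(2)[OF i, of ?y]
    by (subst DERIV_deriv_iff_real_differentiable) auto
  ultimately show "((\<lambda>t. f (restrict (x(i := t)) {1..n})) has_real_derivative partial i f ?y) (at (x i))"
    using i by simp
qed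

text \<open>The weights differ by the factor \<open>exp (- F (M - S))\<close>, which lies between
  \<open>exp (- eps)\<close> and \<open>exp eps\<close>.\<close>

lemma weight_bounds:
  assumes "\<And>u. \<bar>F u\<bar> \<le> eps"
  shows "full_weight F {1..n} M x \<le> exp eps * weight F n M x"
    and "weight F n M x \<le> exp eps * full_weight F {1..n} M x"
proof -
  note One_nat_def [simp del]
  let ?t = "M - (\<Sum>i=1..n. x i)"
  have "weight F n M x = full_weight F {1..n} M x * exp (- F ?t)"
    by (simp add: weight_def full_weight_eq V_def[of F ?t] mult_exp_exp)
  moreover have "exp (- F ?t) \<le> exp eps" "1 \<le> exp eps * exp (- F ?t)"
    using assms[of ?t] by (simp_all add: mult_exp_exp abs_le_iff)
  ultimately show "full_weight F {1..n} M x \<le> exp eps * weight F n M x"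
    "weight F n M x \<le> exp eps * full_weight F {1..n} M x"
    using mult_left_mono[OF _ full_weight_nonneg[of F "{1..n}" M x]]
    by (force simp: mult.commute mult.left_commute)+
qed

text \<open>Otherwise the density would be \<open>0\<close> everywhere, since
  \<open>x / 0 = 0\<close> and \<open>ennreal\<close> sends negative numbers to \<open>0\<close>;
  the total mass could not be \<open>1\<close>.\<close>

lemma Z_sigma_pos:
  assumes "continuous_on UNIV F" "bounded (range F)"
  shows "Z_sigma F n M > 0"
proof (rule ccontr)
  assume "\<not> Z_sigma F n M > 0"
  then have "ennreal (weight F n M x / Z_sigma F n M) = 0" for x
    by (intro ennreal_neg divide_nonneg_nonpos) (simp_all add: weight_def)
  then have "emeasure (sigma_meas F n M) (space (sigma_meas F n M)) = 0"
    unfolding sigma_meas_def by (simp add: emeasure_density)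
  then show False
    using prob_space.emeasure_space_1[OF prob_space_sigma_meas[OF assms]] by simp
qed

text \<open>\<open>weight_bounds\<close> is used once on each side of \<open>full_poincare\<close>,
  which gives \<open>exp (2 * eps)\<close>, while \<open>Z_sigma\<close> cancels. The nonnegative
  integral of \<open>(f - c)\<^sup>2\<close> is bounded first: its finiteness yields square
  integrability of \<open>f\<close>, and the variance is at most this second moment about
  \<open>c\<close>.\<close>

lemma sigma_poincare:
  assumes F: "continuous_on UNIV F" "\<And>u. \<bar>F u\<bar> \<le> eps" and small: "exp (2 * eps) < 2"
    and f: "smooth_Rn n f" and int: "integrable (sigma_meas F n M) (grad_sq n f)"
  shows "integrable (sigma_meas F n M) (\<lambda>x. (f x)\<^sup>2) \<and>
    Var (sigma_meas F n M) f \<le> exp (2 * eps) / (2 * exp (- 2 * eps) - 1) * Expect (sigma_meas F n M) (grad_sq n f)"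
proof -
  note One_nat_def [simp del]
  let ?L = "Pi\<^sub>M {1..n} (\<lambda>_. lborel) :: (nat \<Rightarrow> real) measure"
  let ?Q = "sigma_meas F n M"
  let ?W = "full_weight F {1..n} M"
  let ?Z = "Z_sigma F n M"
  let ?al = "2 * exp (- 2 * eps) - 1"
  define u where "u x = f (restrict x {1..n})" for x
  define D where "D i x = partial i f (restrict x {1..n})" for i x
  have C1: "C1_on {1..n} u D"
    using smooth_Rn_C1_on[OF f] by (simp add: u_def[abs_def] D_def[abs_def])
  have bdd: "bounded (range F)"
    using F(2) by (auto simp: bounded_iff)
  interpret Q: prob_space ?Q
    by (rule prob_space_sigma_meas[OF F(1) bdd])
  have Z: "?Z > 0" by (rule Z_sigma_pos[OF F(1) bdd])
  have al: "?al > 0" using small by (simp add: exp_minus divide_simps)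
  have restr: "restrict x {1..n} = x" if "x \<in> space ?L" for x
    using that by (simp add: space_PiM PiE_restrict)
  have w_nonneg: "weight F n M x \<ge> 0" for x by (simp add: weight_def)
  have [measurable]: "F \<in> borel_measurable borel"
    using F(1) by (rule borel_measurable_continuous_onI)
  have w_meas[measurable]: "weight F n M \<in> borel_measurable ?L"
    unfolding weight_def[abs_def] V_def by measurable
  have W_meas[measurable]: "?W \<in> borel_measurable ?L"
    by (rule full_weight_measurable[OF F(1)])
  have u_meas: "u \<in> borel_measurable ?L"
    using C1 by (intro borel_measurable_PiM_continuous) (simp add: C1_on_def)
  have f_meas[measurable]: "f \<in> borel_measurable ?L"
    by (rule measurable_cong[THEN iffD1, OF _ u_meas]) (simp add: u_def restr)
  have D_meas: "(\<lambda>x. \<Sum>i\<in>{1..n}. (D i x)\<^sup>2) \<in> borel_measurable ?L"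
    using C1 by (intro borel_measurable_PiM_continuous continuous_intros) (simp add: C1_on_def)
  have grad: "grad_sq n f x = (\<Sum>i\<in>{1..n}. (D i x)\<^sup>2)" if "x \<in> space ?L" for x
    by (simp add: grad_sq_def D_def restr[OF that])
  have G_meas[measurable]: "grad_sq n f \<in> borel_measurable ?L"
    by (rule measurable_cong[THEN iffD1, OF _ D_meas]) (simp add: grad)
  have G_nonneg: "grad_sq n f x \<ge> 0" for x
    by (simp add: grad_sq_def sum_nonneg)
  have Q_int: "integrable ?Q \<phi> \<longleftrightarrow> integrable ?L (\<lambda>x. weight F n M x / ?Z * \<phi> x)"
    and Q_eq: "integral\<^sup>L ?Q \<phi> = (\<integral>x. weight F n M x / ?Z * \<phi> x \<partial>?L)"
    if "\<phi> \<in> borel_measurable ?L" for \<phi> :: "_ \<Rightarrow> real"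
    using that w_nonneg Z unfolding sigma_meas_def
    by (auto simp: integrable_density integral_density)
  have G_int: "integrable ?L (\<lambda>x. exp eps * ?Z * (weight F n M x / ?Z * grad_sq n f x))"
    using int unfolding Q_int[OF G_meas] by (rule integrable_mult_right)
  have WG_le: "grad_sq n f x * ?W x \<le> exp eps * ?Z * (weight F n M x / ?Z * grad_sq n f x)" for x
    using mult_right_mono[OF weight_bounds(1)[where F = F and n = n and M = M and x = x, OF F(2)] G_nonneg[of x]] Z
    by (simp add: mult.commute mult.left_commute)
  have WG_int: "integrable ?L (\<lambda>x. grad_sq n f x * ?W x)"
  proof (rule Bochner_Integration.integrable_bound[OF G_int])
    have "norm (grad_sq n f x * ?W x) = grad_sq n f x * ?W x" for x
      by (simp add: G_nonneg full_weight_nonneg)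
    then show "AE x in ?L. norm (grad_sq n f x * ?W x) \<le> norm (exp eps * ?Z * (weight F n M x / ?Z * grad_sq n f x))"
      by (intro AE_I2) (simp only: real_norm_def order_trans[OF WG_le abs_ge_self])
  qed measurable
  have "integrable ?L (\<lambda>x. (\<Sum>i\<in>{1..n}. (D i x)\<^sup>2) * ?W x)"
    using WG_int by (rule Bochner_Integration.integrable_cong[THEN iffD1, OF refl, rotated]) (simp add: grad)
  from full_poincare[OF F small _ C1 this] obtain c where
    "(\<integral>\<^sup>+x. ennreal ((u x - c)\<^sup>2 * ?W x) \<partial>?L) \<le> ennreal ((\<integral>x. (\<Sum>i\<in>{1..n}. (D i x)\<^sup>2) * ?W x \<partial>?L) / ?al)"
    by auto
  also have "(\<integral>\<^sup>+x. ennreal ((u x - c)\<^sup>2 * ?W x) \<partial>?L) = (\<integral>\<^sup>+x. ennreal ((f x - c)\<^sup>2 * ?W x) \<partial>?L)"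
    by (intro nn_integral_cong) (simp add: u_def restr)
  also have "(\<integral>x. (\<Sum>i\<in>{1..n}. (D i x)\<^sup>2) * ?W x \<partial>?L) = (\<integral>x. grad_sq n f x * ?W x \<partial>?L)"
    by (intro Bochner_Integration.integral_cong refl) (simp add: grad)
  finally have c: "(\<integral>\<^sup>+x. ennreal ((f x - c)\<^sup>2 * ?W x) \<partial>?L)
      \<le> ennreal ((\<integral>x. grad_sq n f x * ?W x \<partial>?L) / ?al)" .
  define B where "B = exp (2 * eps) / ?al * Expect ?Q (grad_sq n f)"
  have B_nonneg: "B \<ge> 0"
    unfolding B_def Expect_def using al G_nonneg by (intro mult_nonneg_nonneg Bochner_Integration.integral_nonneg) auto
  have "(\<integral>x. grad_sq n f x * ?W x \<partial>?L) \<le> exp eps * ?Z * Expect ?Q (grad_sq n f)"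
    using integral_mono[OF WG_int G_int WG_le] unfolding Expect_def Q_eq[OF G_meas] integral_mult_right_zero .
  then have WG_bound: "exp eps / ?Z * ((\<integral>x. grad_sq n f x * ?W x \<partial>?L) / ?al) \<le> B"
  proof -
    assume "(\<integral>x. grad_sq n f x * ?W x \<partial>?L) \<le> exp eps * ?Z * Expect ?Q (grad_sq n f)"
    then have "exp eps / ?Z * ((\<integral>x. grad_sq n f x * ?W x \<partial>?L) / ?al)
        \<le> exp eps / ?Z * (exp eps * ?Z * Expect ?Q (grad_sq n f) / ?al)"
      using Z al by (intro mult_left_mono divide_right_mono) auto
    also have "\<dots> = exp eps * exp eps / ?al * Expect ?Q (grad_sq n f)"
      using Z by simp
    finally show ?thesis by (simp add: B_def mult_exp_exp)
  qed
  have "(\<integral>\<^sup>+x. ennreal ((f x - c)\<^sup>2) \<partial>?Q) = (\<integral>\<^sup>+x. ennreal (weight F n M x / ?Z) * ennreal ((f x - c)\<^sup>2) \<partial>?L)"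
    unfolding sigma_meas_def by (rule nn_integral_density) measurable
  also have "\<dots> \<le> (\<integral>\<^sup>+x. ennreal (exp eps / ?Z) * ennreal ((f x - c)\<^sup>2 * ?W x) \<partial>?L)"
  proof (rule nn_integral_mono)
    fix x
    have "weight F n M x / ?Z * (f x - c)\<^sup>2 \<le> exp eps * ?W x / ?Z * (f x - c)\<^sup>2"
      using Z by (intro mult_right_mono divide_right_mono weight_bounds(2) F(2)) auto
    then have "weight F n M x / ?Z * (f x - c)\<^sup>2 \<le> exp eps / ?Z * ((f x - c)\<^sup>2 * ?W x)"
      by (simp add: mult.commute mult.left_commute)
    then show "ennreal (weight F n M x / ?Z) * ennreal ((f x - c)\<^sup>2) \<le> ennreal (exp eps / ?Z) * ennreal ((f x - c)\<^sup>2 * ?W x)"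
      using Z by (simp add: ennreal_mult'[symmetric] w_nonneg ennreal_leI)
  qed
  also have "\<dots> = ennreal (exp eps / ?Z) * (\<integral>\<^sup>+x. ennreal ((f x - c)\<^sup>2 * ?W x) \<partial>?L)"
    by (rule nn_integral_cmult) measurable
  also have "\<dots> \<le> ennreal (exp eps / ?Z) * ennreal ((\<integral>x. grad_sq n f x * ?W x \<partial>?L) / ?al)"
    by (rule mult_left_mono[OF c]) simp
  also have "\<dots> \<le> ennreal B"
    using WG_bound Z by (simp add: ennreal_mult'[symmetric] ennreal_leI)
  finally have nn: "(\<integral>\<^sup>+x. ennreal ((f x - c)\<^sup>2) \<partial>?Q) \<le> ennreal B" .
  have f_meas_Q[measurable]: "f \<in> borel_measurable ?Q"
    unfolding sigma_meas_def by simp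
  have sq_int: "integrable ?Q (\<lambda>x. (f x - c)\<^sup>2)"
    by (rule integrableI_bounded) (use nn in \<open>auto simp: less_top[symmetric] top_unique\<close>)
  have sq_le: "(\<integral>x. (f x - c)\<^sup>2 \<partial>?Q) \<le> B"
    using nn nn_integral_eq_integral[OF sq_int] B_nonneg by simp
  have diff_int: "integrable ?Q (\<lambda>x. f x - c)"
    by (rule Q.square_integrable_imp_integrable[OF _ sq_int]) measurable
  have eq: "(f x)\<^sup>2 = (f x - c)\<^sup>2 + 2 * c * (f x - c) + c\<^sup>2" for x
    by (simp add: power2_eq_square algebra_simps)
  have f2_int: "integrable ?Q (\<lambda>x. (f x)\<^sup>2)"
    unfolding eq using sq_int diff_int by auto
  have "Expect ?Q f = (\<integral>x. (f x - c) + c \<partial>?Q)"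
    by (simp add: Expect_def)
  also have "\<dots> = (\<integral>x. f x - c \<partial>?Q) + c"
    using diff_int by (subst Bochner_Integration.integral_add) (auto simp: Q.prob_space)
  finally have 1: "Expect ?Q f = (\<integral>x. f x - c \<partial>?Q) + c" .
  have "Expect ?Q (\<lambda>x. (f x)\<^sup>2) = (\<integral>x. (f x - c)\<^sup>2 \<partial>?Q) + 2 * c * (\<integral>x. f x - c \<partial>?Q) + c\<^sup>2"
    unfolding Expect_def eq by (simp add: sq_int diff_int Q.prob_space)
  then have "Var ?Q f = (\<integral>x. (f x - c)\<^sup>2 \<partial>?Q) - (\<integral>x. f x - c \<partial>?Q)\<^sup>2"
    unfolding Var_def 1 by (simp add: power2_eq_square algebra_simps)
  also have "\<dots> \<le> B"
    using sq_le by (smt (verit) zero_le_power2)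
  finally show ?thesis
    using f2_int by (simp add: B_def)
qed

theorem proposition0p2:
  shows "\<exists>\<delta>>0. \<exists>P :: real \<Rightarrow> real.
    \<forall>F. C2 F \<and> bounded (range F) \<and> sup_norm F < \<delta> \<longrightarrow>
      P (sup_norm F) > 0 \<and>
      (\<forall>n\<ge>1. \<forall>M f.
        smooth_Rn n f \<and> integrable (sigma_meas F n M) (grad_sq n f) \<longrightarrow>
          integrable (sigma_meas F n M) (\<lambda>x. (f x)\<^sup>2) \<and>
          Var (sigma_meas F n M) f
            \<le> P (sup_norm F) * Expect (sigma_meas F n M) (grad_sq n f))"
\<comment> \<open>Norms below \<open>ln 2 / 2\<close> are those with
  \<open>exp (2 * sup_norm F) < 2\<close>. In the witness for \<open>P\<close>,
  \<open>1 / (2 * exp (- 2 * s) - 1)\<close> is the constant for the Hamiltonian without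
  \<open>F (M - S)\<close>, and \<open>exp (2 * s)\<close> is the price of restoring that
  term.\<close>
proof (intro exI[of _ "ln 2 / 2"] exI[of _ "\<lambda>s. exp (2 * s) / (2 * exp (- 2 * s) - 1)"] conjI allI impI)
  fix F assume F: "C2 F \<and> bounded (range F) \<and> sup_norm F < ln 2 / 2"
  then have "exp (2 * sup_norm F) < exp (ln 2)" by (subst exp_less_cancel_iff) simp
  then have small: "exp (2 * sup_norm F) < 2" by simp
  then show "exp (2 * sup_norm F) / (2 * exp (- 2 * sup_norm F) - 1) > 0"
    by (simp add: exp_minus divide_simps)
  have cont: "continuous_on UNIV F"
    using F unfolding C2_def by (meson DERIV_isCont continuous_at_imp_continuous_on)
  have "bdd_above (range (\<lambda>u. \<bar>F u\<bar>))"
    using F by (auto simp: bounded_iff bdd_above_def)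
  then have bound: "\<bar>F u\<bar> \<le> sup_norm F" for u
    unfolding sup_norm_def by (intro cSUP_upper) auto
  fix n M f
  assume "smooth_Rn n f \<and> integrable (sigma_meas F n M) (grad_sq n f)"
  then show "integrable (sigma_meas F n M) (\<lambda>x. (f x)\<^sup>2)"
    "Var (sigma_meas F n M) f \<le> exp (2 * sup_norm F) / (2 * exp (- 2 * sup_norm F) - 1)
      * Expect (sigma_meas F n M) (grad_sq n f)"
    using sigma_poincare[OF cont bound small] by blast+
qed simp

end
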